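(* Let $n,k$ be integers with $n\geq k\geq 4$. Then $$\operatorname{gr}_k(P_5:P_n)=\begin{cases} n+1, & \text{if } 2(k-1)\leq n\leq 4(k-2)+1,\\ \left\lceil\frac{3n-3}{2}\right\rceil, & \text{if } n>4(k-2)+1.\end{cases}$$
   Context: $P_n$ denotes the path on $n$ vertices. For graphs $G,H$ and a positive integer $k$, the Gallai-Ramsey number $\operatorname{gr}_k(G:H)$ is the minimum integer $N$ such that for every $n'\geq N$, every exact $k$-edge-coloring of the complete graph $K_{n'}$ (an edge-coloring in which exactly $k$ colors are used) contains either a rainbow copy of $G$ (a copy all of whose edges have pairwise distinct colors) or a monochromatic copy of $H$ (a copy all of whose edges have the same color). Copies are subgraphs, not necessarily induced; edge-colorings are not required to be proper. *)

theory Defs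
  imports Complex_Main "HOL-Library.Ramsey" "HOL-Library.Extended_Nat"
begin

text \<open>A graph is a pair of a vertex set and a set of edges, each edge being a two-element set of
  vertices.\<close>

type_synonym 'a ugraph = "'a set \<times> 'a set set"

abbreviation uverts :: "'a ugraph \<Rightarrow> 'a set" where
  "uverts \<equiv> fst"

abbreviation uedges :: "'a ugraph \<Rightarrow> 'a set set" where
  "uedges \<equiv> snd"

definition complete_graph :: "nat \<Rightarrow> nat ugraph" where
  "complete_graph n = ({..<n}, nsets {..<n} 2)"

definition path_graph :: "nat \<Rightarrow> nat ugraph" where
  "path_graph n = ({..<n}, {{i, Suc i} | i. Suc i < n})"

definition is_subgraph :: "'a ugraph \<Rightarrow> 'a ugraph \<Rightarrow> bool" where
  "is_subgraph X K \<longleftrightarrow> uverts X \<subseteq> uverts K \<and> uedges X \<subseteq> uedges K \<and> (\<forall>e\<in>uedges X. e \<subseteq> uverts X)"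

definition isomorphic :: "'a ugraph \<Rightarrow> 'b ugraph \<Rightarrow> bool" where
  "isomorphic G X \<longleftrightarrow>
     (\<exists>\<phi>. bij_betw \<phi> (uverts G) (uverts X) \<and> uedges X = (\<lambda>e. \<phi> ` e) ` uedges G)"

definition is_copy_in :: "'b ugraph \<Rightarrow> 'a ugraph \<Rightarrow> 'a ugraph \<Rightarrow> bool" where
  "is_copy_in G K X \<longleftrightarrow> is_subgraph X K \<and> isomorphic G X"

text \<open>Only the values of a colouring on the edges of the graph at hand matter.\<close>

definition exact_edge_coloring :: "nat \<Rightarrow> 'a ugraph \<Rightarrow> ('a set \<Rightarrow> nat) \<Rightarrow> bool" where
  "exact_edge_coloring k K f \<longleftrightarrow> finite (f ` uedges K) \<and> card (f ` uedges K) = k"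

definition rainbow :: "('a set \<Rightarrow> nat) \<Rightarrow> 'a ugraph \<Rightarrow> bool" where
  "rainbow f X \<longleftrightarrow> inj_on f (uedges X)"

definition monochromatic :: "('a set \<Rightarrow> nat) \<Rightarrow> 'a ugraph \<Rightarrow> bool" where
  "monochromatic f X \<longleftrightarrow> (\<exists>c. \<forall>e\<in>uedges X. f e = c)"

definition gr_arrow :: "nat \<Rightarrow> nat \<Rightarrow> 'a ugraph \<Rightarrow> 'b ugraph \<Rightarrow> bool" where
  "gr_arrow m k G H \<longleftrightarrow>
     (\<forall>f. exact_edge_coloring k (complete_graph m) f \<longrightarrow>
        (\<exists>X. is_copy_in G (complete_graph m) X \<and> rainbow f X) \<or>
        (\<exists>X. is_copy_in H (complete_graph m) X \<and> monochromatic f X))"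

text \<open>The infimum in \<^typ>\<open>enat\<close> of a nonempty set is its minimum, and the infimum of the empty set
  is \<open>\<infinity>\<close>; so a finite value asserts in particular that a suitable \<open>N\<close> exists.\<close>

definition gallai_ramsey :: "nat \<Rightarrow> 'a ugraph \<Rightarrow> 'b ugraph \<Rightarrow> enat" where
  "gallai_ramsey k G H = Inf {enat N | N. \<forall>m\<ge>N. gr_arrow m k G H}"

end

theory Submission
  imports Defs
begin

text \<open>
  Upper bound. Let \<open>K\<^sub>m\<close>, \<open>m \<ge> 7\<close>, be coloured with at least four colours and without a rainbow \<open>P\<^sub>5\<close>.
  Then either some colour \<open>d\<close> is dominant, i.e. the vertex sets spanned by the other colours are
  pairwise disjoint, or after deleting one vertex all edges outside a triple of vertices have the
  same colour (a coarse form of a theorem of Thomason and Wagner). In the second case that colour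
  contains a path on \<open>m - 1\<close> vertices. In the first case the edges coloured \<open>d\<close> include those of a
  complete multipartite graph with at least \<open>k - 1\<close> classes of size at least two, which has a path on
  \<open>min m (4 * (k - 2) + 1)\<close> vertices; moreover a connected subgraph avoiding \<open>d\<close> is monochromatic,
  so the two-colour Ramsey theorem of Gerencser and Gyarfas for paths applies to
  ``\<open>d\<close> against all other colours''.

  The dichotomy rests on rainbow triangles. If there is none, two disjoint pairs of colours, each
  meeting at a vertex, yield a rainbow \<open>P\<^sub>5\<close>, so that the pairs of colours that meet form a star. If
  there is one, an edge of a fourth colour determines all other edges up to few exceptions.

  Lower bounds. Colour \<open>K\<^sub>n - v\<close> with one colour and the edges at \<open>v\<close> with the others; respectively
  take a monochromatic \<open>K\<^bsub>n-1\<^esub>\<close> and \<open>k - 2\<close> disjoint further edges of private colours among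
  \<open>n div 2 - 1\<close> further vertices, and one colour for everything else.
\<close>

section \<open>Paths in complete multipartite graphs\<close>

text \<open>Forbidding the class \<open>l\<close> of the first vertex makes the greedy choice of a vertex from a largest
  admissible class go through by induction.\<close>

lemma multipartite_path_avoiding:
  assumes "finite W"
    and "\<And>x. x \<in> W \<Longrightarrow> p x \<noteq> l \<Longrightarrow> 2 * card {y \<in> W. p y = p x} \<le> card W + 1"
    and "2 * card {y \<in> W. p y = l} \<le> card W"
  shows "\<exists>xs. distinct xs \<and> set xs = W \<and> successively (\<lambda>x y. p x \<noteq> p y) xs \<and> (xs \<noteq> [] \<longrightarrow> p (hd xs) \<noteq> l)"
  using assms
proof (induction "card W" arbitrary: W l)
  case 0
  then show ?case by auto
next
  case (Suc N)
  let ?C = "\<lambda>x. card {y \<in> W. p y = p x}"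
  let ?B = "{x \<in> W. p x \<noteq> l}"
  have "?B \<noteq> {}"
  proof
    assume "?B = {}"
    then have "{y \<in> W. p y = l} = W" by auto
    then show False using Suc.prems(3) Suc.hyps(2) by simp
  qed
  then obtain x0 where x0: "x0 \<in> ?B" by blast
  have bound: "?C y \<le> card W" for y
    by (rule card_mono) (use Suc.prems(1) in auto)
  have "\<exists>x. x \<in> ?B \<and> (\<forall>y. y \<in> ?B \<longrightarrow> ?C y \<le> ?C x)"
    by (rule ex_has_greatest_nat[of _ x0 _ "Suc (card W)"]) (use x0 bound in \<open>auto simp: less_Suc_eq_le\<close>)
  then obtain x where x: "x \<in> ?B" "\<And>y. y \<in> ?B \<Longrightarrow> ?C y \<le> ?C x"
    by blast
  let ?W = "W - {x}"
  have N: "card ?W = N" using x(1) Suc.hyps(2) Suc.prems(1) by simp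
  have le: "card {y \<in> ?W. P y} \<le> card {y \<in> W. P y}" for P
    by (rule card_mono) (use Suc.prems(1) in auto)
  have "{y \<in> ?W. p y = p x} = {y \<in> W. p y = p x} - {x}" by auto
  then have "card {y \<in> ?W. p y = p x} = ?C x - 1" using x(1) Suc.prems(1) by simp
  then have own: "2 * card {y \<in> ?W. p y = p x} \<le> card ?W"
    using Suc.prems(2)[of x] x(1) N Suc.hyps(2) by auto
  have other: "2 * card {y \<in> ?W. p y = p z} \<le> card ?W + 1" if z: "z \<in> ?W" "p z \<noteq> p x" for z
  proof (cases "p z = l")
    case True
    then show ?thesis using le[of "\<lambda>y. p y = l"] Suc.prems(3) N Suc.hyps(2) by auto
  next
    case False
    then have "?C z \<le> ?C x" using x(2) z by auto
    moreover have "?C z + ?C x \<le> card W"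
    proof -
      have "?C z + ?C x = card ({y \<in> W. p y = p z} \<union> {y \<in> W. p y = p x})"
        by (rule card_Un_disjoint[symmetric]) (use Suc.prems(1) z in auto)
      then show ?thesis using card_mono[OF Suc.prems(1), of "{y \<in> W. p y = p z} \<union> {y \<in> W. p y = p x}"] by auto
    qed
    ultimately show ?thesis using le[of "\<lambda>y. p y = p z"] N Suc.hyps(2) by linarith
  qed
  obtain xs where xs: "distinct xs" "set xs = ?W" "successively (\<lambda>x y. p x \<noteq> p y) xs"
      "xs \<noteq> [] \<longrightarrow> p (hd xs) \<noteq> p x"
    using Suc.hyps(1)[of ?W "p x"] N other own Suc.prems(1) by auto
  have "distinct (x # xs)" "set (x # xs) = W" using xs(1,2) x(1) by auto
  moreover have "successively (\<lambda>x y. p x \<noteq> p y) (x # xs)"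
    using xs(3,4) by (cases "xs = []") (simp_all add: successively_Cons)
  moreover have "p (hd (x # xs)) \<noteq> l" using x(1) by simp
  ultimately show ?case by blast
qed

lemma multipartite_path:
  assumes "finite W" and "\<And>x. x \<in> W \<Longrightarrow> 2 * card {y \<in> W. p y = p x} \<le> card W + 1"
  obtains xs where "distinct xs" "set xs = W" "successively (\<lambda>x y. p x \<noteq> p y) xs"
proof -
  \<comment> \<open>\<open>None\<close> is the class of no vertex, so nothing is forbidden at the
    start.\<close>
  have "\<exists>xs. distinct xs \<and> set xs = W \<and> successively (\<lambda>x y. Some (p x) \<noteq> Some (p y)) xs \<and>
      (xs \<noteq> [] \<longrightarrow> Some (p (hd xs)) \<noteq> None)"
    by (rule multipartite_path_avoiding[where l = None]) (use assms in auto)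
  then show thesis using that by auto
qed

section \<open>The Ramsey number of a path\<close>

text \<open>The pairs \<open>{2 * j + 1, 2 * j + 2}\<close> with \<open>j < m div 2\<close> are
  disjoint and each meets \<open>D\<close>; the map \<open>(d - 1) div 2\<close> recovers the index
  of the pair.\<close>

lemma card_consecutive_hitting:
  fixes D :: "nat set"
  assumes "finite D" and hit: "\<And>i. 1 \<le> i \<Longrightarrow> Suc i \<le> m \<Longrightarrow> i \<in> D \<or> Suc i \<in> D"
  shows "m div 2 \<le> card D"
proof -
  have "{..<m div 2} \<subseteq> (\<lambda>d. (d - 1) div 2) ` D"
  proof
    fix j assume "j \<in> {..<m div 2}"
    then have "2 * j + 1 \<in> D \<or> 2 * j + 2 \<in> D" using hit[of "2 * j + 1"] by auto
    then show "j \<in> (\<lambda>d. (d - 1) div 2) ` D"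
    proof
      assume "2 * j + 1 \<in> D"
      then show ?thesis by (rule rev_image_eqI) simp
    next
      assume "2 * j + 2 \<in> D"
      then show ?thesis by (rule rev_image_eqI) simp
    qed
  qed
  from surj_card_le[OF assms(1) this] show ?thesis by simp
qed

text \<open>Induction step of the Ramsey theorem for paths, with \<open>R\<close> as red and its
  negation as blue. If no vertex off the red path can prolong it or be inserted into it, the blue
  edges forced by this contain a path on \<open>n\<close> vertices.\<close>

lemma red_path_extension:
  fixes R :: "'a \<Rightarrow> 'a \<Rightarrow> bool"
  assumes sym: "\<And>x y. R x y \<longleftrightarrow> R y x" and V: "finite V" "n + n div 2 - 1 \<le> card V" and n: "3 \<le> n"
    and xs: "distinct xs" "set xs \<subseteq> V" "length xs = n - 1" "successively R xs"
  shows "\<exists>ys. distinct ys \<and> set ys \<subseteq> V \<and> length ys = n \<and>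
    (successively R ys \<or> successively (\<lambda>x y. \<not> R x y) ys)"
proof (rule ccontr)
  assume no: "\<not> ?thesis"
  define t where "t = n div 2"
  have "n div 2 \<le> card (V - set xs)"
    using V n xs card_Diff_subset[of "set xs" V] distinct_card[OF xs(1)] by auto
  then obtain Y where Y: "Y \<subseteq> V - set xs" "card Y = t" "finite Y"
    unfolding t_def by (rule obtain_subset_with_card_n)
  have t: "1 \<le> t" using n by (auto simp: t_def)
  have xsne: "xs \<noteq> []" "2 \<le> length xs" using n xs by auto
  have blue_end: "\<not> R y (hd xs)" "\<not> R (last xs) y" if y: "y \<in> Y" for y
  proof -
    have d: "distinct (y # xs)" "set (y # xs) \<subseteq> V" "length (y # xs) = n"
      "distinct (xs @ [y])" "set (xs @ [y]) \<subseteq> V" "length (xs @ [y]) = n"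
      using y Y xs n by auto
    have "\<not> successively R (y # xs)" "\<not> successively R (xs @ [y])" using no d by blast+
    then show "\<not> R y (hd xs)" "\<not> R (last xs) y"
      using xs(4) by (simp_all add: successively_Cons successively_append_iff)
  qed
  have blue_mid: "\<not> R y (xs ! i) \<or> \<not> R y (xs ! Suc i)" if y: "y \<in> Y" and i: "Suc i < length xs" for y i
  proof (rule ccontr)
    assume red: "\<not> ?thesis"
    define us where "us = take (Suc i) xs"
    define vs where "vs = drop (Suc i) xs"
    have split: "xs = us @ vs" "us \<noteq> []" "vs \<noteq> []" using i by (auto simp: us_def vs_def)
    have "last us = xs ! i" using i by (simp add: us_def take_Suc_conv_app_nth)
    moreover have "hd vs = xs ! Suc i" using i by (simp add: vs_def hd_drop_conv_nth)
    ultimately have "successively R (us @ y # vs)"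
      using xs(4) red sym[of y] split(2,3) unfolding split(1)
      by (auto simp: successively_append_iff successively_Cons)
    moreover have "distinct (us @ y # vs)" "set (us @ y # vs) \<subseteq> V" "length (us @ y # vs) = n"
      using xs y Y n unfolding split(1) by auto
    ultimately show False using no by blast
  qed
  \<comment> \<open>The red path has indices 0 to \<open>n - 2\<close>. Its two ends are set aside:
    they are blue to all of \<open>Y\<close> and will prolong and link blue paths.\<close>
  define I where "I = (!) xs ` {1..n - 3}"
  have I: "I \<subseteq> set xs" using xs n by (auto simp: I_def)
  have inj: "inj_on ((!) xs) {1..n - 3}" using xs n by (auto simp: inj_on_def nth_eq_iff_index_eq)
  have hd_I: "hd xs \<notin> I" and last_I: "last xs \<notin> I"
    using xs n xsne by (auto simp: I_def hd_conv_nth last_conv_nth nth_eq_iff_index_eq)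
  have hd_last: "hd xs \<noteq> last xs"
    using xs n xsne by (auto simp: hd_conv_nth last_conv_nth nth_eq_iff_index_eq)
  have finI: "finite I" by (simp add: I_def)
  have YI: "Y \<inter> I = {}" using Y I by auto
  define B where "B x y \<longleftrightarrow> \<not> R x y" for x y
  have B_sym: "B x y \<longleftrightarrow> B y x" for x y using sym by (simp add: B_def)
  \<comment> \<open>A longest alternating blue path \<open>q\<close>: by maximality, of any two consecutive vertices of \<open>xs\<close> off \<open>q\<close>
    one is blue to all of the rest of \<open>Y\<close>. These vertices carry a second path, joined to \<open>q\<close> via \<open>last xs\<close>.\<close>
  define alt where "alt q \<longleftrightarrow> distinct q \<and> q \<noteq> [] \<and> set q \<subseteq> Y \<union> I \<and> successively B q \<and>
    hd q \<in> Y \<and> last q \<in> Y \<and> card (set q \<inter> Y) = card (set q \<inter> I) + 1" for q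
  obtain y0 where y0: "y0 \<in> Y" using Y t by (metis card.empty ex_in_conv not_one_le_zero)
  have "alt [y0]" unfolding alt_def using y0 YI by (auto simp: disjoint_iff)
  moreover have "length q \<le> card (Y \<union> I)" if "alt q" for q
    using that distinct_card[of q] card_mono[of "Y \<union> I" "set q"] Y(3) finI by (auto simp: alt_def)
  ultimately obtain q where q: "alt q" and q_max: "\<And>q'. alt q' \<Longrightarrow> length q' \<le> length q"
    using ex_has_greatest_nat[of alt "[y0]" length "Suc (card (Y \<union> I))"] by (auto simp: less_Suc_eq_le)
  define Y' where "Y' = Y - set q"
  define F where "F = {w \<in> I - set q. \<forall>y \<in> Y'. B y w}"
  \<comment> \<open>Otherwise \<open>y # w # q\<close> would be a longer alternating path.\<close>
  have no_common: "\<not> (B y w \<and> B w (hd q))" if "y \<in> Y'" "w \<in> I - set q" for y w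
  proof
    assume "B y w \<and> B w (hd q)"
    have "set (y # w # q) \<inter> Y = insert y (set q \<inter> Y)" "set (y # w # q) \<inter> I = insert w (set q \<inter> I)"
      using that YI by (auto simp: Y'_def)
    moreover have "y \<notin> set q" "w \<notin> set q" "y \<noteq> w" "y \<in> Y" "w \<in> I" using that YI by (auto simp: Y'_def)
    ultimately have "alt (y # w # q)"
      using q \<open>B y w \<and> B w (hd q)\<close> unfolding alt_def by (auto simp: successively_Cons)
    then show False using q_max by fastforce
  qed
  define D where "D = {i \<in> {1..n - 3}. xs ! i \<in> (set q \<inter> I) \<union> F}"
  have "(n - 3) div 2 \<le> card D"
  proof (rule card_consecutive_hitting)
    fix i assume i: "1 \<le> i" "Suc i \<le> n - 3"
    then have I': "xs ! i \<in> I" "xs ! Suc i \<in> I" by (auto simp: I_def)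
    have B_mid: "B y (xs ! i) \<or> B y (xs ! Suc i)" if "y \<in> Y" for y
      using blue_mid[OF that, of i] i xs(3) by (auto simp: B_def)
    have "hd q \<in> Y" using q by (simp add: alt_def)
    show "i \<in> D \<or> Suc i \<in> D"
    \<comment> \<open>If neither vertex counts, each has a red neighbour in \<open>Y'\<close>, which
      by \<open>B_mid\<close> is blue to the other vertex. By \<open>no_common\<close> both vertices
      are then red to \<open>hd q\<close>, against \<open>B_mid\<close>.\<close>
    proof (rule ccontr)
      assume "\<not> ?thesis"
      then have nD: "xs ! i \<notin> set q" "xs ! Suc i \<notin> set q" "xs ! i \<notin> F" "xs ! Suc i \<notin> F"
        using i I' by (auto simp: D_def)
      then obtain y z where "y \<in> Y'" "z \<in> Y'" "\<not> B y (xs ! i)" "\<not> B z (xs ! Suc i)"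
        using I' unfolding F_def by blast
      moreover from this have "B y (xs ! Suc i)" "B z (xs ! i)" using B_mid by (auto simp: Y'_def)
      ultimately show False
        using no_common[of y "xs ! Suc i"] no_common[of z "xs ! i"] I' nD B_mid[OF \<open>hd q \<in> Y\<close>] B_sym by blast
    qed
  qed (simp add: D_def)
  also have "card D = card ((!) xs ` D)"
    by (rule card_image[symmetric]) (rule inj_on_subset[OF inj], auto simp: D_def)
  also have "\<dots> \<le> card ((set q \<inter> I) \<union> F)"
    by (rule card_mono) (use finI in \<open>auto simp: D_def F_def\<close>)
  also have "\<dots> \<le> card (set q \<inter> I) + card F" by (rule card_Un_le)
  finally have cF: "(n - 3) div 2 \<le> card (set q \<inter> I) + card F" .
  have cq: "card (set q \<inter> Y) = card (set q \<inter> I) + 1" using q by (simp add: alt_def)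
  have "Y = (set q \<inter> Y) \<union> Y'" by (auto simp: Y'_def)
  then have cY: "t = card (set q \<inter> Y) + card Y'"
    using card_Un_disjoint[of "set q \<inter> Y" Y'] Y by (auto simp: Y'_def)
  have cY': "card Y' \<le> card F + 1" using cF cq cY n unfolding t_def by linarith
  \<comment> \<open>By \<open>cY'\<close>, \<open>F'\<close> is as large as \<open>Y'\<close> or one
    smaller, so the two sets admit an alternating path starting in \<open>Y'\<close>.\<close>
  obtain F' where F': "F' \<subseteq> F" "card F' = min (card F) (card Y')" "finite F'"
    using obtain_subset_with_card_n[of "min (card F) (card Y')" F] by auto
  have YF: "Y' \<inter> F' = {}" using F' YI by (auto simp: F_def Y'_def)
  have finY': "finite Y'" using Y by (simp add: Y'_def)
  have cYF: "card (Y' \<union> F') = card Y' + card F'"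
    using card_Un_disjoint[OF finY' F'(3) YF] .
  have "\<exists>xs. distinct xs \<and> set xs = Y' \<union> F' \<and> successively (\<lambda>x y. (x \<in> Y') \<noteq> (y \<in> Y')) xs \<and>
    (xs \<noteq> [] \<longrightarrow> (hd xs \<in> Y') \<noteq> False)"
  proof (rule multipartite_path_avoiding)
    show "finite (Y' \<union> F')" using finY' F' by simp
    have "{y \<in> Y' \<union> F'. (y \<in> Y') = False} = F'" "{y \<in> Y' \<union> F'. (y \<in> Y') = True} = Y'" using YF by auto
    then show "2 * card {y \<in> Y' \<union> F'. (y \<in> Y') = False} \<le> card (Y' \<union> F')"
      "\<And>x. (x \<in> Y') \<noteq> False \<Longrightarrow> 2 * card {y \<in> Y' \<union> F'. (y \<in> Y') = (x \<in> Y')} \<le> card (Y' \<union> F') + 1"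
      using cYF F'(2) cY' by auto
  qed
  then obtain s where s: "distinct s" "set s = Y' \<union> F'" "successively (\<lambda>x y. (x \<in> Y') \<noteq> (y \<in> Y')) s"
    "s \<noteq> [] \<longrightarrow> hd s \<in> Y'" by auto
  have sB: "successively B s"
  proof (rule successively_mono[OF s(3)])
    fix x y assume "x \<in> set s" "y \<in> set s" "(x \<in> Y') \<noteq> (y \<in> Y')"
    then show "B x y" using s(2) F'(1) B_sym unfolding F_def by blast
  qed
  define ys where "ys = hd xs # q @ last xs # s"
  have xsV: "hd xs \<in> V" "last xs \<in> V" "hd xs \<notin> Y" "last xs \<notin> Y" using xs xsne Y by auto
  have q': "distinct q" "q \<noteq> []" "set q \<subseteq> Y \<union> I" "successively B q" "hd q \<in> Y" "last q \<in> Y"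
    using q by (auto simp: alt_def)
  have s': "set s \<inter> set q = {}" "set s \<subseteq> Y \<union> I" using s(2) F'(1) by (auto simp: F_def Y'_def)
  have "Y \<union> I \<subseteq> V" "hd xs \<notin> Y \<union> I" "last xs \<notin> Y \<union> I"
    using Y(1) I xs(2) xsV hd_I last_I by auto
  then have ys: "distinct ys" "set ys \<subseteq> V"
    using q'(1,3) s(1) s' xsV(1,2) hd_last unfolding ys_def by (simp_all, blast+)
  have "B (hd xs) (hd q)" "B (last q) (last xs)" "s \<noteq> [] \<Longrightarrow> B (last xs) (hd s)"
    using blue_end q'(5,6) s(4) B_sym unfolding B_def Y'_def by blast+
  then have ysB: "successively B ys"
    using q' sB by (auto simp: ys_def successively_Cons successively_append_iff)
  have "set q = (set q \<inter> Y) \<union> (set q \<inter> I)" using q' by auto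
  then have "length q = card (set q \<inter> Y) + card (set q \<inter> I)"
    using distinct_card[OF q'(1)] card_Un_disjoint[of "set q \<inter> Y" "set q \<inter> I"] YI by fastforce
  moreover have "length s = card Y' + card F'" using distinct_card[OF s(1)] s(2) cYF by simp
  \<comment> \<open>The length is \<open>2 * t + 1\<close> if \<open>card F' = card Y'\<close>;
    otherwise it is \<open>2 * t\<close>, and the count allows this only for even
    \<open>n\<close>.\<close>
  ultimately have "n \<le> length ys"
    using cF cq cY F'(2) n unfolding ys_def t_def by auto
  then have "length (take n ys) = n" "successively B (take n ys)" "distinct (take n ys)" "set (take n ys) \<subseteq> V"
    using ys ysB set_take_subset[of n ys] successively_append_iff[of B "take n ys" "drop n ys"] by auto
  then show False using no unfolding B_def by blast
qed

text \<open>Induction on \<open>n\<close>: the colour of the path found so far plays red in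
  \<open>red_path_extension\<close>. The bound on \<open>card V\<close> is the two-colour Ramsey
  number of the path on \<open>n\<close> vertices.\<close>

lemma gerencser_gyarfas:
  fixes g :: "'a \<Rightarrow> 'a \<Rightarrow> bool"
  assumes sym: "\<And>x y. g x y = g y x" and V: "finite V"
    and n: "2 \<le> n" "n + n div 2 - 1 \<le> card V"
  shows "\<exists>c xs. distinct xs \<and> set xs \<subseteq> V \<and> length xs = n \<and> successively (\<lambda>x y. g x y = c) xs"
  using n
proof (induction n rule: nat_induct_at_least)
  case base
  then obtain W where "W \<subseteq> V" "card W = 2" using obtain_subset_with_card_n[of 2 V] by auto
  then obtain x y where "x \<noteq> y" "{x, y} \<subseteq> V" by (auto simp: card_2_iff)
  then show ?case by (intro exI[of _ "g x y"] exI[of _ "[x, y]"]) auto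
next
  case (Suc n)
  have "n + n div 2 - 1 \<le> card V" using Suc.prems by linarith
  then obtain c xs where xs: "distinct xs" "set xs \<subseteq> V" "length xs = n" "successively (\<lambda>x y. g x y = c) xs"
    using Suc.IH by blast
  have "\<exists>ys. distinct ys \<and> set ys \<subseteq> V \<and> length ys = Suc n \<and>
    (successively (\<lambda>x y. g x y = c) ys \<or> successively (\<lambda>x y. g x y \<noteq> c) ys)"
    by (rule red_path_extension[where xs = xs]) (use sym V Suc xs in auto)
  moreover have "(\<lambda>x y. g x y \<noteq> c) = (\<lambda>x y. g x y = (\<not> c))" by auto
  ultimately show ?case by metis
qed

section \<open>Colourings without a rainbow \<open>P\<^sub>5\<close>\<close>

text \<open>Seven vertices leave three outside a four-cycle, as the pigeonhole argument for
  \<open>no_rainbow_C4\<close> uses.\<close>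

locale rainbow_P5_free =
  fixes V :: "'a set" and g :: "'a \<Rightarrow> 'a \<Rightarrow> 'c"
  assumes finite_V: "finite V" and card_V: "7 \<le> card V"
    and g_sym: "g x y = g y x"
    and no_rainbow: "\<lbrakk>distinct [p, q, r, s, t]; set [p, q, r, s, t] \<subseteq> V\<rbrakk> \<Longrightarrow>
      \<not> distinct [g p q, g q r, g r s, g s t]"
begin

section \<open>Rainbow four-cycles\<close>

lemma P5_D:
  assumes "distinct [p, q, r, s, t]" "set [p, q, r, s, t] \<subseteq> V" "distinct [g q r, g r s, g s t]"
  shows "g p q \<in> {g q r, g r s, g s t}"
  using no_rainbow[OF assms(1,2)] assms(3) by auto

lemma fresh_vertex:
  assumes "length xs < 7"
  obtains z where "z \<in> V" "z \<notin> set xs"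
proof -
  have "card (set xs) < card V"
    using card_length[of xs] assms card_V by linarith
  then have "\<not> V \<subseteq> set xs"
    using card_mono[of "set xs" V] by fastforce
  then show thesis using that by blast
qed

text \<open>The paths from \<open>x\<close> to \<open>a\<close> and on around the cycle in either
  direction each leave three colours for \<open>g x a\<close>; only two are common to both.\<close>

lemma rainbow_C4_outward:
  assumes "distinct [a, b, c, d, x]" "set [a, b, c, d, x] \<subseteq> V"
    and "distinct [g a b, g b c, g c d, g d a]"
  shows "g x a = g b c \<or> g x a = g c d"
  using P5_D[of x a b c d] P5_D[of x a d c b] assms
  by (auto simp: g_sym)

text \<open>The vertex \<open>x\<close> can replace \<open>b\<close> or \<open>d\<close> to give
  another rainbow four-cycle through \<open>a\<close>. Applying \<open>rainbow_C4_outward\<close> to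
  both cycles leaves for \<open>g y a\<close> only a value other than \<open>g x a\<close>.\<close>

lemma rainbow_C4_differ:
  assumes d: "distinct [a, b, c, d, x, y]" and V: "set [a, b, c, d, x, y] \<subseteq> V"
    and C4: "distinct [g a b, g b c, g c d, g d a]"
  shows "g x a \<noteq> g y a"
proof -
  have xa: "g x a = g b c \<or> g x a = g c d"
    using rainbow_C4_outward[of a b c d x] d V C4 by auto
  have xc: "g x c = g d a \<or> g x c = g a b"
    using rainbow_C4_outward[of c d a b x] d V C4 by auto
  have ya: "g y a = g b c \<or> g y a = g c d"
    using rainbow_C4_outward[of a b c d y] d V C4 by auto
  have n1: "\<not> distinct [g b a, g a x, g x c, g c d]" using no_rainbow[of b a x c d] d V by auto
  have n2: "\<not> distinct [g d a, g a x, g x c, g c b]" using no_rainbow[of d a x c b] d V by auto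
  consider "g x a = g b c" "g x c = g a b" | "g x a = g c d" "g x c = g d a"
    using xa xc n1 n2 C4 by (simp add: g_sym[of _ a] g_sym[of c b]) metis
  then show ?thesis
  proof cases
    case 1
    have "g y a = g x c \<or> g y a = g c d"
      using rainbow_C4_outward[of a x c d y] d V C4 1 g_sym[of a x] by auto
    then show ?thesis using 1 C4 ya by auto
  next
    case 2
    have "g y a = g x c \<or> g y a = g c b"
      using rainbow_C4_outward[of a x c b y] d V C4 2 g_sym[of a x] g_sym[of c b] g_sym[of b a] by auto
    then show ?thesis using 2 C4 ya g_sym[of c b] by auto
  qed
qed

text \<open>Three outside vertices would send pairwise different colours to \<open>a\<close>, but
  only two are available.\<close>

lemma no_rainbow_C4:
  assumes d: "distinct [a, b, c, d]" and V: "set [a, b, c, d] \<subseteq> V"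
  shows "\<not> distinct [g a b, g b c, g c d, g d a]"
proof
  assume C4: "distinct [g a b, g b c, g c d, g d a]"
  obtain x where x: "x \<in> V" "x \<notin> set [a, b, c, d]" by (rule fresh_vertex[of "[a, b, c, d]"]) auto
  obtain y where y: "y \<in> V" "y \<notin> set [a, b, c, d, x]"
    by (rule fresh_vertex[of "[a, b, c, d, x]"]) auto
  obtain z where z: "z \<in> V" "z \<notin> set [a, b, c, d, x, y]"
    by (rule fresh_vertex[of "[a, b, c, d, x, y]"]) auto
  have "g x a \<noteq> g y a" "g x a \<noteq> g z a" "g y a \<noteq> g z a"
    using rainbow_C4_differ[OF _ _ C4] d V x y z by auto
  moreover have "g w a = g b c \<or> g w a = g c d" if "w \<in> {x, y, z}" for w
    using rainbow_C4_outward[OF _ _ C4, of w] that d V x y z by auto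
  ultimately show False by (metis insertI1 insertI2)
qed

text \<open>This covers all the non-dominant colourings with at least four colours: a vertex off a
  monochromatic graph, a rainbow triangle, and an exceptional \<open>K\<^sub>4\<close> (take \<open>a\<close> and \<open>S\<close> inside it).\<close>

definition near_mono :: bool where
  "near_mono \<longleftrightarrow> (\<exists>a S d. card S \<le> 3 \<and> S \<subseteq> V \<and> a \<in> V \<and>
     (\<forall>x \<in> V - {a}. \<forall>y \<in> V - {a}. x \<noteq> y \<longrightarrow> \<not> (x \<in> S \<and> y \<in> S) \<longrightarrow> g x y = d))"

section \<open>Rainbow triangles and a fourth colour\<close>

definition rainbow_triangle :: "'a \<Rightarrow> 'a \<Rightarrow> 'a \<Rightarrow> bool" where
  "rainbow_triangle a b c \<longleftrightarrow> distinct [a, b, c] \<and> set [a, b, c] \<subseteq> V \<and> distinct [g a b, g b c, g c a]"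

lemma rainbow_triangle_rotate: "rainbow_triangle a b c \<Longrightarrow> rainbow_triangle b c a"
  by (auto simp: rainbow_triangle_def)

lemma rainbow_triangle_swap: "rainbow_triangle a b c \<Longrightarrow> rainbow_triangle b a c"
  using g_sym[of a b] g_sym[of b c] g_sym[of c a] by (auto simp: rainbow_triangle_def)

text \<open>The paths through \<open>y\<close>, \<open>x\<close>, \<open>a\<close> and around the
  triangle either way allow \<open>{\<delta>, g a b, g b c}\<close> and
  \<open>{\<delta>, g c a, g b c}\<close>, respectively.\<close>

lemma triangle_outward:
  assumes T: "rainbow_triangle a b c" and d: "g x y = \<delta>" "\<delta> \<notin> {g a b, g b c, g c a}"
    and xy: "x \<in> V - {a, b, c}" "y \<in> V - {a, b, c}" "x \<noteq> y"
  shows "g x a = \<delta> \<or> g x a = g b c"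
  using no_rainbow[of y x a b c] no_rainbow[of y x a c b] T d xy
  unfolding rainbow_triangle_def by (auto simp: g_sym)

text \<open>Four paths start with \<open>z\<close>, \<open>w\<close>, enter the triangle at
  \<open>b\<close> or \<open>c\<close> and go around it either way. No colour but
  \<open>\<delta>\<close> is allowed for \<open>g w z\<close> by all of them.\<close>

lemma triangle_two_new:
  assumes T: "rainbow_triangle a b c" and d: "g w b = \<delta>" "g w c = \<delta>" "\<delta> \<notin> {g a b, g b c, g c a}"
    and wz: "w \<in> V - {a, b, c}" "z \<in> V - {a, b, c}" "w \<noteq> z"
  shows "g w z = \<delta>"
  using no_rainbow[of z w b a c] no_rainbow[of z w b c a] no_rainbow[of z w c a b] no_rainbow[of z w c b a]
    T d wz
  unfolding rainbow_triangle_def by (auto simp: g_sym)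

text \<open>By \<open>triangle_outward\<close> the only alternative is \<open>g y b = g c a\<close>,
  which would make \<open>x\<close>, \<open>a\<close>, \<open>b\<close>, \<open>y\<close> a rainbow
  four-cycle.\<close>

lemma triangle_exceptions:
  assumes T: "rainbow_triangle a b c" and d: "\<delta> \<notin> {g a b, g b c, g c a}"
    and w: "x \<in> V - {a, b, c}" "y \<in> V - {a, b, c}" "x \<noteq> y" "g x y = \<delta>"
    and e: "g x a = g b c"
  shows "g y b = \<delta>"
proof -
  have "g y b = \<delta> \<or> g y b = g c a"
    using triangle_outward[OF rainbow_triangle_rotate[OF T], of y x \<delta>] d w by (auto simp: g_sym)
  then show ?thesis
    using no_rainbow_C4[of x a b y] T d w e
    unfolding rainbow_triangle_def by (auto simp: g_sym)
qed

lemma triangle_reorder: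
  assumes T: "rainbow_triangle a b c" and pq: "p \<in> {a, b, c}" "q \<in> {a, b, c}" "p \<noteq> q"
  obtains r where "rainbow_triangle p q r" "{p, q, r} = {a, b, c}"
    "{g p q, g q r, g r p} = {g a b, g b c, g c a}"
proof -
  obtain r where r: "(p, q, r) \<in> {(a, b, c), (b, c, a), (c, a, b), (b, a, c), (a, c, b), (c, b, a)}"
    using pq by auto
  show thesis
  proof (rule that[of r])
    show "rainbow_triangle p q r"
      using r T rainbow_triangle_rotate[of a b c] rainbow_triangle_rotate[of b c a]
        rainbow_triangle_swap[of a b c] rainbow_triangle_swap[of b c a] rainbow_triangle_swap[of c a b]
      by auto
    show "{p, q, r} = {a, b, c}" using r by auto
    show "{g p q, g q r, g r p} = {g a b, g b c, g c a}"
      using r g_sym[of a b] g_sym[of b c] g_sym[of a c] by auto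
  qed
qed

text \<open>All edges off the triangle turn out to have colour \<open>\<delta>\<close>, and no two
  exceptional edges, those between \<open>U\<close> and the triangle of another colour, are
  disjoint. So the exceptional edges share a vertex: on the triangle it is deleted, in
  \<open>U\<close> it is put into the exceptional triple.\<close>

lemma near_mono_if_triangle_and_disjoint_edge:
  assumes T: "rainbow_triangle a b c" and new: "\<delta> \<notin> {g a b, g b c, g c a}"
    and xy: "x \<in> V - {a, b, c}" "y \<in> V - {a, b, c}" "x \<noteq> y" "g x y = \<delta>"
  shows near_mono
proof -
  define U where "U = V - {a, b, c}"
  have abc: "a \<in> V" "b \<in> V" "c \<in> V" "a \<noteq> b" "b \<noteq> c" "a \<noteq> c"
    using T by (auto simp: rainbow_triangle_def)
  have outward: "g u p = \<delta> \<or> g u p = g q r"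
    if "rainbow_triangle p q r" "{p, q, r} = {a, b, c}" "{g p q, g q r, g r p} = {g a b, g b c, g c a}"
      "u \<in> U" "v \<in> U" "u \<noteq> v" "g u v = \<delta>" for u v p q r
    using triangle_outward[OF that(1,7)] that new unfolding U_def by metis
  have cross_edge: "g u p = \<delta> \<or> g v q = \<delta>"
    if uv: "u \<in> U" "v \<in> U" "u \<noteq> v" "g u v = \<delta>" and pq: "p \<in> {a, b, c}" "q \<in> {a, b, c}" "p \<noteq> q" for u v p q
  proof -
    obtain r where r: "rainbow_triangle p q r" "{p, q, r} = {a, b, c}"
        "{g p q, g q r, g r p} = {g a b, g b c, g c a}"
      by (rule triangle_reorder[OF T pq])
    then show ?thesis
      using outward[OF r uv] triangle_exceptions[OF r(1) _ _ _ uv(3,4)] uv new unfolding U_def by metis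
  qed
  have good: "g w z = \<delta>"
    if w: "w \<in> U" "z \<in> U" "w \<noteq> z" and qr: "q \<in> {a, b, c}" "r \<in> {a, b, c}" "q \<noteq> r"
      and d: "g w q = \<delta>" "g w r = \<delta>" for w z q r
  proof -
    obtain p where "rainbow_triangle q r p" "{q, r, p} = {a, b, c}"
        "{g q r, g r p, g p q} = {g a b, g b c, g c a}"
      by (rule triangle_reorder[OF T qr])
    then have "rainbow_triangle p q r" "{p, q, r} = {a, b, c}"
        "{g p q, g q r, g r p} = {g a b, g b c, g c a}"
      using rainbow_triangle_rotate by blast+
    then show ?thesis using triangle_two_new[of p q r w \<delta> z] w d new unfolding U_def by metis
  qed
  have bad: "\<exists>p \<in> {a, b, c}. \<exists>q \<in> {a, b, c}. p \<noteq> q \<and> g w p \<noteq> \<delta> \<and> g w q \<noteq> \<delta>"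
    if "w \<in> U" "z \<in> U" "w \<noteq> z" "g w z \<noteq> \<delta>" for w z
    using good[OF that(1-3), of a b] good[OF that(1-3), of b c] good[OF that(1-3), of a c] that(4) abc
    by blast
  \<comment> \<open>One of \<open>x\<close>, \<open>y\<close> sends \<open>\<delta>\<close> to all
    of \<open>U\<close>: otherwise \<open>bad\<close> gives each of them two exceptional edges to
    the triangle, and disjoint ones among these contradict \<open>cross_edge\<close>.\<close>
  obtain w where w: "w \<in> U" "\<And>z. z \<in> U \<Longrightarrow> z \<noteq> w \<Longrightarrow> g w z = \<delta>"
  proof -
    have "(\<forall>z \<in> U. z \<noteq> x \<longrightarrow> g x z = \<delta>) \<or> (\<forall>z \<in> U. z \<noteq> y \<longrightarrow> g y z = \<delta>)"
    proof (rule ccontr)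
      assume "\<not> ?thesis"
      then obtain z z' where "z \<in> U" "z \<noteq> x" "g x z \<noteq> \<delta>" "z' \<in> U" "z' \<noteq> y" "g y z' \<noteq> \<delta>" by blast
      then show False using bad[of x z] bad[of y z'] cross_edge[of x y] xy unfolding U_def by metis
    qed
    then show thesis using that xy unfolding U_def by blast
  qed
  \<comment> \<open>This is \<open>cross_edge\<close> for arbitrary \<open>g u v\<close>: the vertex
    \<open>w\<close> supplies the edge of colour \<open>\<delta>\<close> in the path
    \<open>u\<close>, \<open>p\<close>, \<open>q\<close>, \<open>v\<close>,
    \<open>w\<close>.\<close>
  have cross: "g u p = \<delta> \<or> g v q = \<delta>"
    if uv: "u \<in> U" "v \<in> U" "u \<noteq> v" and pq: "p \<in> {a, b, c}" "q \<in> {a, b, c}" "p \<noteq> q" for u v p q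
  proof (cases "w \<in> {u, v}")
    case True
    then show ?thesis using cross_edge[OF uv _ pq] w uv g_sym[of u v] by auto
  next
    case False
    obtain r where r: "rainbow_triangle p q r" "{p, q, r} = {a, b, c}"
        "{g p q, g q r, g r p} = {g a b, g b c, g c a}"
      by (rule triangle_reorder[OF T pq])
    have r': "rainbow_triangle q r p" "{q, r, p} = {a, b, c}"
        "{g q r, g r p, g p q} = {g a b, g b c, g c a}"
      using r rainbow_triangle_rotate by blast+
    have uw: "g u w = \<delta>" and vw: "g v w = \<delta>" using w False uv g_sym by auto
    have u: "g u p = \<delta> \<or> g u p = g q r" using outward[OF r, of u w] uv w uw False by auto
    have v: "g v q = \<delta> \<or> g v q = g r p" using outward[OF r', of v w] uv w vw False by auto
    have "distinct [u, p, q, v, w]" "set [u, p, q, v, w] \<subseteq> V"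
      using uv pq False w(1) abc unfolding U_def by auto
    from no_rainbow[OF this] show ?thesis
      using u v r vw new g_sym[of q v] unfolding rainbow_triangle_def by auto
  qed
  have U_mono: "g u v = \<delta>" if "u \<in> U" "v \<in> U" "u \<noteq> v" for u v
    using bad[of u v] bad[of v u] that cross[of u v] g_sym[of u v] by metis
  show ?thesis
  proof (cases "\<exists>z p z' q. z \<in> U \<and> p \<in> {a, b, c} \<and> z' \<in> U \<and> q \<in> {a, b, c} \<and> p \<noteq> q \<and> g z p \<noteq> \<delta> \<and> g z' q \<noteq> \<delta>")
    case True
    then obtain z p z' q where z: "z \<in> U" "p \<in> {a, b, c}" "z' \<in> U" "q \<in> {a, b, c}" "p \<noteq> q"
      "g z p \<noteq> \<delta>" "g z' q \<noteq> \<delta>" by blast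
    then have "z' = z" using cross by metis
    then have "g u r = \<delta>" if "u \<in> U" "u \<noteq> z" "r \<in> {a, b, c}" for u r
      using that cross[of u z r p] cross[of u z r q] z by metis
    then have "\<forall>x \<in> V - {a}. \<forall>y \<in> V - {a}. x \<noteq> y \<longrightarrow> \<not> (x \<in> {z, b, c} \<and> y \<in> {z, b, c}) \<longrightarrow> g x y = \<delta>"
      using U_mono g_sym unfolding U_def by (metis Diff_iff insert_iff empty_iff)
    moreover have "card {z, b, c} \<le> 3" by (simp add: card_insert_if)
    ultimately show ?thesis unfolding near_mono_def
      using abc z(1) by (intro exI[of _ a] exI[of _ "{z, b, c}"] exI[of _ \<delta>]) (auto simp: U_def)
  next
    case False
    obtain p where p: "p \<in> {a, b, c}" "\<And>u r. \<lbrakk>u \<in> U; r \<in> {a, b, c}; r \<noteq> p\<rbrakk> \<Longrightarrow> g u r = \<delta>"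
      using False by (metis insertI1)
    have "\<forall>x \<in> V - {p}. \<forall>y \<in> V - {p}. x \<noteq> y \<longrightarrow>
        \<not> (x \<in> {a, b, c} - {p} \<and> y \<in> {a, b, c} - {p}) \<longrightarrow> g x y = \<delta>"
      using U_mono p g_sym unfolding U_def by (metis Diff_iff insert_iff empty_iff)
    moreover have "card ({a, b, c} - {p}) \<le> 3"
      using card_mono[of "{a, b, c}" "{a, b, c} - {p}"] card_length[of "[a, b, c]"] by auto
    ultimately show ?thesis unfolding near_mono_def
      using abc p(1) by (intro exI[of _ p] exI[of _ "{a, b, c} - {p}"] exI[of _ \<delta>]) auto
  qed
qed

text \<open>Paths and four-cycles force the colour \<open>g c a\<close> on every edge that avoids
  \<open>b\<close>, except possibly from \<open>x\<close> to \<open>a\<close> and to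
  \<open>c\<close>. If one of these two differs, its ends and \<open>b\<close> form a rainbow
  triangle to which \<open>g c a\<close> is new, and two further vertices provide a disjoint edge of
  that colour.\<close>

lemma near_mono_if_triangle_and_adjacent_edge:
  assumes T: "rainbow_triangle a b c"
    and U: "\<And>u v. \<lbrakk>u \<in> V - {a, b, c}; v \<in> V - {a, b, c}; u \<noteq> v\<rbrakk> \<Longrightarrow> g u v \<in> {g a b, g b c, g c a}"
    and x: "x \<in> V - {a, b, c}" and new: "g x b \<notin> {g a b, g b c, g c a}"
  shows near_mono
proof -
  have abc: "a \<in> V" "b \<in> V" "c \<in> V" "a \<noteq> b" "b \<noteq> c" "a \<noteq> c"
    and colors: "g a b \<noteq> g b c" "g a b \<noteq> g c a" "g b c \<noteq> g c a"
    using T by (auto simp: rainbow_triangle_def)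
  note sym = g_sym[of b x] g_sym[of b a] g_sym[of c b] g_sym[of a c]
  have yx: "g y x = g c a" if y: "y \<in> V - {a, b, c}" "y \<noteq> x" for y
    using no_rainbow[of y x b a c] no_rainbow[of y x b c a] U[of y x] y x abc colors new sym by auto
  have ya: "g y a = g c a" if y: "y \<in> V - {a, b, c}" "y \<noteq> x" for y
    using no_rainbow[of x b c a y] no_rainbow_C4[of b x y a] no_rainbow[of x y a b c]
      yx[OF y] y x abc colors new sym g_sym[of x y] g_sym[of a y] by auto
  have yc: "g y c = g c a" if y: "y \<in> V - {a, b, c}" "y \<noteq> x" for y
    using no_rainbow[of x b a c y] no_rainbow_C4[of b x y c] no_rainbow[of x y c b a]
      yx[OF y] y x abc colors new sym g_sym[of x y] g_sym[of c y] by auto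
  have zy: "g z y = g c a" if zy: "y \<in> V - {a, b, c}" "y \<noteq> x" "z \<in> V - {a, b, c}" "z \<noteq> x" "z \<noteq> y" for z y
    using no_rainbow[of z y x b a] no_rainbow[of z y x b c] U[of z y] yx[OF zy(1,2)] zy x abc colors new sym by auto
  obtain y where y: "y \<in> V - {a, b, c}" "y \<noteq> x"
    by (rule fresh_vertex[of "[a, b, c, x]"]) auto
  obtain z where z: "z \<in> V - {a, b, c}" "z \<noteq> x" "z \<noteq> y"
    by (rule fresh_vertex[of "[a, b, c, x, y]"]) auto
  have xa: "g x a = g c a \<or> g x a = g b c"
    using no_rainbow[of c b x a y] no_rainbow[of c b a x y] ya[OF y] yx[OF y] y x abc colors new sym
      g_sym[of x y] g_sym[of a y] g_sym[of a x] by auto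
  have xc: "g x c = g c a \<or> g x c = g a b"
    using no_rainbow[of a b x c y] no_rainbow[of a b c x y] yc[OF y] yx[OF y] y x abc colors new sym
      g_sym[of x y] g_sym[of c y] g_sym[of c x] by auto
  consider "g x a = g c a" "g x c = g c a" | "g x a = g b c" | "g x c = g a b" using xa xc by blast
  then show ?thesis
  proof cases
    case 1
    obtain \<kappa> where \<kappa>: "\<kappa> = g c a" by blast
    have "g u v = \<kappa>" if "u \<in> V - {b}" "v \<in> V - {b}" "u \<noteq> v" for u v
      using yx ya yc zy 1 g_sym that unfolding \<kappa> by (metis DiffD1 DiffD2 DiffI insert_iff empty_iff)
    then show ?thesis unfolding near_mono_def
      using abc by (intro exI[of _ b] exI[of _ "{}"]) auto
  next
    case 2
    have "rainbow_triangle x a b"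
      using 2 x abc colors new sym unfolding rainbow_triangle_def by auto
    then show ?thesis
      using near_mono_if_triangle_and_disjoint_edge[of x a b "g c a" z y] zy[OF y z] 2 y z x colors new sym by auto
  next
    case 3
    have "rainbow_triangle x c b"
      using 3 x abc colors new sym unfolding rainbow_triangle_def by auto
    then show ?thesis
      using near_mono_if_triangle_and_disjoint_edge[of x c b "g c a" z y] zy[OF y z] 3 y z x colors new sym by auto
  qed
qed

lemma near_mono_if_triangle:
  assumes T: "rainbow_triangle a b c" and new: "g x y \<notin> {g a b, g b c, g c a}"
    and xy: "x \<in> V" "y \<in> V" "x \<noteq> y"
  shows near_mono
proof (rule ccontr)
  assume neg: "\<not> near_mono"
  have U: "g u v \<in> {g a b, g b c, g c a}" if "u \<in> V - {a, b, c}" "v \<in> V - {a, b, c}" "u \<noteq> v" for u v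
    using near_mono_if_triangle_and_disjoint_edge[OF T _ that] neg by auto
  have adj: "g u p \<in> {g a b, g b c, g c a}" if u: "u \<in> V - {a, b, c}" and p: "p \<in> {a, b, c}" for u p
  proof -
    obtain q where q: "q \<in> {a, b, c}" "q \<noteq> p"
      using T unfolding rainbow_triangle_def by auto
    obtain r where r: "rainbow_triangle q p r" "{q, p, r} = {a, b, c}"
        "{g q p, g p r, g r q} = {g a b, g b c, g c a}"
      by (rule triangle_reorder[OF T q(1) p q(2)])
    show ?thesis
      using near_mono_if_triangle_and_adjacent_edge[OF r(1), of u] U that(1) neg unfolding r(2,3) by blast
  qed
  have tri: "g p q \<in> {g a b, g b c, g c a}" if "p \<in> {a, b, c}" "q \<in> {a, b, c}" "p \<noteq> q" for p q
    using that g_sym[of b a] g_sym[of c b] g_sym[of a c] by auto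
  show False using U[of x y] adj[of x y] adj[of y x] tri[of x y] g_sym[of x y] new xy by (metis Diff_iff)
qed

section \<open>Colours that meet at a vertex\<close>

definition touch :: "'c \<Rightarrow> 'c \<Rightarrow> bool" where
  "touch i j \<longleftrightarrow> i \<noteq> j \<and> (\<exists>x y z. {x, y, z} \<subseteq> V \<and> x \<noteq> y \<and> x \<noteq> z \<and> g x y = i \<and> g x z = j)"

lemma touch_sym: "touch i j \<longleftrightarrow> touch j i"
  unfolding touch_def by auto

lemma gallai_cherry:
  assumes "\<And>a b c. \<not> rainbow_triangle a b c"
    and "distinct [x, y, z]" "set [x, y, z] \<subseteq> V" "g x y \<noteq> g x z"
  shows "g y z = g x y \<or> g y z = g x z"
  using assms(1)[of x y z] assms(2-) g_sym[of z x] unfolding rainbow_triangle_def by auto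

text \<open>Without rainbow triangles, \<open>g a b\<close> repeats \<open>g v a\<close> or
  \<open>g v b\<close>, and likewise for \<open>g c d\<close>. With \<open>a\<close>,
  \<open>b\<close> and \<open>c\<close>, \<open>d\<close> in suitable order, the path through both
  pairs and \<open>v\<close> shows all four colours of the star.\<close>

lemma rainbow_triangle_if_rainbow_star:
  assumes V: "distinct [v, a, b, c, d]" "set [v, a, b, c, d] \<subseteq> V"
    and star: "distinct [g v a, g v b, g v c, g v d]"
  shows "\<exists>a b c. rainbow_triangle a b c"
proof (rule ccontr)
  assume gal: "\<not> ?thesis"
  have "g a b = g v a \<or> g a b = g v b" "g c d = g v c \<or> g c d = g v d"
    using gal gallai_cherry[of v a b] gallai_cherry[of v c d] V star by auto
  then show False
    using no_rainbow[of a b v c d] no_rainbow[of b a v c d] no_rainbow[of a b v d c] no_rainbow[of b a v d c]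
      V star by (auto simp: g_sym)
qed

text \<open>If \<open>u\<close> is \<open>x\<close> or \<open>y\<close>, then \<open>u\<close>,
  \<open>v\<close>, \<open>w\<close> span a rainbow triangle. Otherwise \<open>g x y\<close> repeats
  \<open>g w x\<close> or \<open>g w y\<close>, and continuing \<open>u\<close>, \<open>v\<close>,
  \<open>w\<close> through \<open>x\<close> and \<open>y\<close> in the right order gives a rainbow
  path.\<close>

lemma rainbow_triangle_if_rainbow_tree:
  assumes V: "set [u, v, w, x, y] \<subseteq> V" "u \<noteq> v" "distinct [v, w, x, y]" "u \<noteq> w"
    and tree: "distinct [g u v, g v w, g w x, g w y]"
  shows "\<exists>a b c. rainbow_triangle a b c"
proof (rule ccontr)
  assume gal: "\<not> ?thesis"
  have "u \<noteq> x" "u \<noteq> y"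
    using gal V tree g_sym[of w x] g_sym[of x v] g_sym[of w y] g_sym[of y v]
    unfolding rainbow_triangle_def by (metis distinct_length_2_or_more distinct_singleton insert_subset list.simps(15))+
  moreover have "g x y = g w x \<or> g x y = g w y"
    using gal gallai_cherry[of w x y] V tree by auto
  moreover have "\<not> distinct [g u v, g v w, g w x, g x y]" if "u \<noteq> x" "u \<noteq> y"
    using no_rainbow[of u v w x y] V that by auto
  moreover have "\<not> distinct [g u v, g v w, g w y, g x y]" if "u \<noteq> x" "u \<noteq> y"
    using no_rainbow[of u v w y x] V that g_sym[of y x] by auto
  ultimately show False
    using tree by (metis distinct_length_2_or_more distinct_singleton)
qed

text \<open>Let \<open>v\<close> and \<open>w\<close> be the centres of the two cherries. If they
  differ, the colour of the edge between them is missing from one cherry; that cherry, this edge and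
  a suitable edge of the other cherry form a rainbow tree.\<close>

lemma rainbow_triangle_if_disjoint_touch:
  assumes t: "touch i j" "touch k l" and d: "distinct [i, j, k, l]"
  shows "\<exists>a b c. rainbow_triangle a b c"
proof -
  obtain v a b where v: "{v, a, b} \<subseteq> V" "v \<noteq> a" "v \<noteq> b" "g v a = i" "g v b = j"
    using t(1) unfolding touch_def by auto
  obtain w c e where w: "{w, c, e} \<subseteq> V" "w \<noteq> c" "w \<noteq> e" "g w c = k" "g w e = l"
    using t(2) unfolding touch_def by auto
  have ne: "a \<noteq> b" "c \<noteq> e" using v w d by auto
  show ?thesis
  proof (cases "v = w")
    case True
    then show ?thesis using rainbow_triangle_if_rainbow_star[of v a b c e] v w d by auto
  next
    case False
    have half: "\<exists>a b c. rainbow_triangle a b c"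
      if v: "{v, a, b} \<subseteq> V" "v \<noteq> a" "v \<noteq> b" "g v a = i" "g v b = j"
        and w: "{w, c, e} \<subseteq> V" "w \<noteq> c" "w \<noteq> e" "g w c = k" "g w e = l"
        and d: "distinct [i, j, k, l]" and vw: "v \<noteq> w" "g v w \<noteq> k" "g v w \<noteq> l"
      for v a b w c e i j k l
    proof -
      obtain u where u: "u \<in> {a, b}" "g v u \<noteq> g v w" using v d by (metis distinct_length_2_or_more insertI1 insertI2)
      have "u \<noteq> w" "v \<noteq> c" "v \<noteq> e" "c \<noteq> e" using u w d vw g_sym[of v w] by auto
      then show ?thesis
        using rainbow_triangle_if_rainbow_tree[of u v w c e] v w d vw u g_sym[of u v] by auto
    qed
    show ?thesis
    proof (cases "g v w \<in> {k, l}")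
      case True
      have "g w v \<noteq> i" "g w v \<noteq> j" using True d g_sym[of v w] by auto
      moreover have "distinct [k, l, i, j]" using d by auto
      ultimately show ?thesis using half[OF w v] \<open>v \<noteq> w\<close> by blast
    next
      case False
      then show ?thesis using half[OF v w d] \<open>v \<noteq> w\<close> by blast
    qed
  qed
qed

definition colors :: "'c set" where
  "colors = {g x y | x y. x \<in> V \<and> y \<in> V \<and> x \<noteq> y}"

text \<open>For edges \<open>x\<close>, \<open>y\<close> of colour \<open>i\<close> and
  \<open>z\<close>, \<open>w\<close> of colour \<open>j\<close> with \<open>x\<close> not in the
  second, the edge from \<open>x\<close> to \<open>z\<close> has colour \<open>i\<close> and meets
  \<open>j\<close> at \<open>z\<close>, or has another colour and meets \<open>i\<close> at
  \<open>x\<close>.\<close>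

lemma colors_touch:
  assumes i: "i \<in> colors" "j \<in> colors" "i \<noteq> j"
  shows "touch i j \<or> (\<exists>c. c \<noteq> i \<and> c \<noteq> j \<and> touch i c)"
proof -
  obtain x y z w where x: "x \<in> V" "y \<in> V" "x \<noteq> y" "g x y = i" and z: "z \<in> V" "w \<in> V" "z \<noteq> w" "g z w = j"
    using i unfolding colors_def by auto
  have g: "g y x = i" "g w z = j" using x z g_sym by auto
  have share: "touch i j" if "{p, q, r} \<subseteq> V" "p \<noteq> q" "p \<noteq> r" "g p q = i" "g p r = j" for p q r
    using that i(3) unfolding touch_def by blast
  have sharec: "touch i c" if "{p, q, r} \<subseteq> V" "p \<noteq> q" "p \<noteq> r" "g p q = i" "g p r = c" "c \<noteq> i" for p q r c
    using that unfolding touch_def by blast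
  show ?thesis
  proof (cases "x = z \<or> x = w")
    case True
    then show ?thesis using share[of x y] x z g by auto
  next
    case False
    then show ?thesis
      using share[of z x w] sharec[of x y z "g x z"] x z g_sym[of x z] by (metis bot.extremum insert_subset)
  qed
qed

definition dominant :: "'c \<Rightarrow> bool" where
  "dominant d \<longleftrightarrow> (\<forall>i j. touch i j \<longrightarrow> i = d \<or> j = d)"

lemma touch_colors: "touch i j \<Longrightarrow> i \<in> colors \<and> j \<in> colors"
  unfolding touch_def colors_def by blast

text \<open>The touching relation is a connected graph on at least four colours, so it contains two disjoint
  edges unless it is a star, whose centre is then dominant.\<close>

lemma dominant_if_no_disjoint_touch:
  assumes four: "4 \<le> card colors"
    and no: "\<And>i j k l. \<lbrakk>touch i j; touch k l\<rbrakk> \<Longrightarrow> \<not> distinct [i, j, k, l]"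
  shows "\<exists>d. dominant d"
proof (rule ccontr)
  assume neg: "\<nexists>d. dominant d"
  then obtain p q where pq: "touch p q" unfolding dominant_def by blast
  \<comment> \<open>Since \<open>p\<close> is not dominant, some touching pair omits
    \<open>p\<close>; not being disjoint from \<open>{p, q}\<close>, it contains
    \<open>q\<close>.\<close>
  obtain r where r: "touch q r" "r \<noteq> p" using neg no pq touch_sym unfolding dominant_def
    by (metis (no_types, lifting) distinct_length_2_or_more distinct_singleton touch_def)
  obtain s where s: "touch p s" "s \<noteq> q" using neg no pq touch_sym unfolding dominant_def
    by (metis (no_types, lifting) distinct_length_2_or_more distinct_singleton touch_def)
  have ne: "p \<noteq> q" "q \<noteq> r" "p \<noteq> s" using pq r s unfolding touch_def by auto
  have "s = r" using no[OF r(1) s(1)] ne r s by auto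
  \<comment> \<open>The colours \<open>p\<close>, \<open>q\<close>, \<open>r\<close> touch pairwise.
    Whatever a fourth colour touches, the resulting pair is disjoint from one of these three
    pairs.\<close>
  have "card {p, q, r} < card colors" using four by (simp add: card_insert_if)
  then obtain t where t: "t \<in> colors" "t \<notin> {p, q, r}"
    by (metis card_mono finite.emptyI finite_insert leD subsetI)
  obtain c where "touch t c" using colors_touch[OF t(1), of p] touch_colors[OF pq] t by auto
  moreover have "c \<noteq> t" using \<open>touch t c\<close> unfolding touch_def by auto
  ultimately show False
    using no[OF pq \<open>touch t c\<close>] no[OF r(1) \<open>touch t c\<close>] no[OF s(1) \<open>touch t c\<close>] t(2) ne r(2) \<open>s = r\<close> by auto
qed

lemma near_mono_or_dominant:
  assumes four: "4 \<le> card colors"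
  shows "near_mono \<or> (\<exists>d. dominant d)"
proof (cases "\<exists>a b c. rainbow_triangle a b c")
  case True
  then obtain a b c where T: "rainbow_triangle a b c" by blast
  have "card {g a b, g b c, g c a} < card colors" using four by (simp add: card_insert_if)
  then obtain t where "t \<in> colors" "t \<notin> {g a b, g b c, g c a}"
    by (metis card_mono finite.emptyI finite_insert leD subsetI)
  then show ?thesis using near_mono_if_triangle[OF T] unfolding colors_def by blast
next
  case False
  then show ?thesis using dominant_if_no_disjoint_touch[OF four] rainbow_triangle_if_disjoint_touch by blast
qed

section \<open>Long monochromatic paths\<close>

lemma near_mono_path:
  assumes near_mono
  shows "\<exists>c xs. distinct xs \<and> set xs \<subseteq> V \<and> length xs = card V - 1 \<and> successively (\<lambda>x y. g x y = c) xs"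
proof -
  obtain a S d where S: "card S \<le> 3" "S \<subseteq> V" "a \<in> V"
    and d: "\<And>x y. \<lbrakk>x \<in> V - {a}; y \<in> V - {a}; x \<noteq> y; \<not> (x \<in> S \<and> y \<in> S)\<rbrakk> \<Longrightarrow> g x y = d"
    using assms unfolding near_mono_def by metis
  \<comment> \<open>\<open>S\<close> is one class and all other vertices are singletons. Classes of
    size at most three are small enough by \<open>card_V\<close>.\<close>
  define p where "p x = (if x \<in> S then None else Some x)" for x
  have W: "card (V - {a}) = card V - 1" using S(3) finite_V by simp
  have "2 * card {y \<in> V - {a}. p y = p x} \<le> card (V - {a}) + 1" for x
  proof -
    have "card {y \<in> V - {a}. p y = p x} \<le> 3"
    proof (cases "x \<in> S")
      case True
      have "card {y \<in> V - {a}. p y = p x} \<le> card S"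
        by (rule card_mono) (use True S finite_V finite_subset in \<open>auto simp: p_def split: if_splits\<close>)
      then show ?thesis using S(1) by simp
    next
      case False
      then have "card {y \<in> V - {a}. p y = p x} \<le> card {x}"
        by (intro card_mono) (auto simp: p_def split: if_splits)
      then show ?thesis by simp
    qed
    then show ?thesis using W card_V by linarith
  qed
  then obtain xs where xs: "distinct xs" "set xs = V - {a}" "successively (\<lambda>x y. p x \<noteq> p y) xs"
    using multipartite_path[of "V - {a}" p] finite_V by blast
  have "successively (\<lambda>x y. g x y = d) xs"
  proof (rule successively_mono[OF xs(3)])
    fix x y assume "x \<in> set xs" "y \<in> set xs" "p x \<noteq> p y"
    moreover from this have "x \<noteq> y" "\<not> (x \<in> S \<and> y \<in> S)" by (auto simp: p_def)
    ultimately show "g x y = d" using d xs(2) by simp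
  qed
  moreover have "length xs = card V - 1" using distinct_card[OF xs(1)] xs(2) W by simp
  ultimately show ?thesis using xs by blast
qed

lemma dominant_edges:
  assumes "dominant d" "{x, y, z} \<subseteq> V" "x \<noteq> y" "x \<noteq> z" "g x y \<noteq> d" "g x z \<noteq> d"
  shows "g x y = g x z"
  using assms unfolding dominant_def touch_def by blast

text \<open>Edges between classes of vertices with different non-dominant colours have colour
  \<open>d\<close>. If no class is too large, there is a path through all of \<open>V\<close>.
  Otherwise each of at least \<open>card colors - 2\<close> further colours has two vertices outside
  the large class, and a path alternates between the outside vertices and that class.\<close>

lemma dominant_long_path:
  assumes d: "dominant d" and n: "n \<le> card V" "n \<le> 4 * (card colors - 2) + 1"
  shows "\<exists>xs. distinct xs \<and> set xs \<subseteq> V \<and> n \<le> length xs \<and> successively (\<lambda>x y. g x y = d) xs"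
proof -
  \<comment> \<open>\<open>Inl\<close> records the only colour other than \<open>d\<close> at
    \<open>v\<close>; \<open>Inr v\<close> makes a vertex without such a colour a class of its
    own.\<close>
  define p where "p v = (if \<exists>u \<in> V. u \<noteq> v \<and> g v u \<noteq> d
    then Inl (g v (SOME u. u \<in> V \<and> u \<noteq> v \<and> g v u \<noteq> d)) else Inr v)" for v
  have p_eq: "p v = Inl (g v u)" if "v \<in> V" "u \<in> V" "u \<noteq> v" "g v u \<noteq> d" for u v
  proof -
    let ?w = "SOME u. u \<in> V \<and> u \<noteq> v \<and> g v u \<noteq> d"
    have "?w \<in> V \<and> ?w \<noteq> v \<and> g v ?w \<noteq> d" by (rule someI[of _ u]) (use that in auto)
    then have "g v u = g v ?w" using dominant_edges[OF d, of v u ?w] that by auto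
    then show ?thesis using that unfolding p_def by auto
  qed
  have p_d: "g u v = d" if "u \<in> V" "v \<in> V" "p u \<noteq> p v" for u v
    using p_eq[of u v] p_eq[of v u] that g_sym[of u v] by metis
  have path: "\<exists>xs. distinct xs \<and> set xs = W \<and> successively (\<lambda>x y. g x y = d) xs"
    if W: "W \<subseteq> V" and part: "\<And>x. x \<in> W \<Longrightarrow> 2 * card {y \<in> W. p y = p x} \<le> card W + 1" for W
  proof -
    have "finite W" using W finite_V finite_subset by blast
    then obtain xs where xs: "distinct xs" "set xs = W" "successively (\<lambda>x y. p x \<noteq> p y) xs"
      using multipartite_path[of W p] part by blast
    have "successively (\<lambda>x y. g x y = d) xs"
      by (rule successively_mono[OF xs(3)]) (use p_d W xs(2) in blast)
    then show ?thesis using xs by blast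
  qed
  show ?thesis
  proof (cases "\<forall>x \<in> V. 2 * card {y \<in> V. p y = p x} \<le> card V + 1")
    case True
    then obtain xs where "distinct xs" "set xs = V" "successively (\<lambda>x y. g x y = d) xs"
      using path[of V] by blast
    moreover from this have "n \<le> length xs" using n(1) distinct_card[of xs] by simp
    ultimately show ?thesis by blast
  next
    case False
    then obtain x where x: "x \<in> V" "card V + 1 < 2 * card {y \<in> V. p y = p x}" by force
    define C where "C = {y \<in> V. p y = p x}"
    define O' where "O' = V - C"
    have C: "C \<subseteq> V" "finite C" "finite O'" using finite_V by (auto simp: C_def O'_def)
    have cV: "card V = card C + card O'"
      using card_Diff_subset[OF C(2,1)] card_mono[OF finite_V C(1)] by (simp add: O'_def)
    define E where "E = {e \<in> colors - {d}. Inl e \<noteq> p x}"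
    have finc: "finite colors"
    proof -
      have "colors \<subseteq> (\<lambda>(x, y). g x y) ` (V \<times> V)" unfolding colors_def by auto
      then show ?thesis using finite_V finite_subset by blast
    qed
    have "card colors - 2 \<le> card E"
    proof -
      \<comment> \<open>If \<open>p x\<close> is an \<open>Inr\<close>, then
        \<open>projl (p x)\<close> is an unspecified value, which at worst enlarges the right-hand
        side.\<close>
      have "colors \<subseteq> insert d (insert (projl (p x)) E)"
      proof
        fix e assume "e \<in> colors"
        then show "e \<in> insert d (insert (projl (p x)) E)"
          by (cases "Inl e = p x") (auto simp: E_def dest: sym)
      qed
      then have "card colors \<le> card (insert d (insert (projl (p x)) E))"
        by (rule card_mono[rotated]) (use finc in \<open>simp add: E_def\<close>)
      also have "\<dots> \<le> card E + 2" using finc by (simp add: card_insert_if E_def)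
      finally show ?thesis by simp
    qed
    moreover have "2 * card E \<le> card O'"
    proof -
      have "2 \<le> card {y \<in> O'. p y = Inl e}" if "e \<in> E" for e
      proof -
        obtain u v where uv: "u \<in> V" "v \<in> V" "u \<noteq> v" "g u v = e" "e \<noteq> d"
          using \<open>e \<in> E\<close> unfolding E_def colors_def by auto
        then have "p u = Inl e" "p v = Inl e" using p_eq[of u v] p_eq[of v u] g_sym[of u v] by auto
        then have "{u, v} \<subseteq> {y \<in> O'. p y = Inl e}" using uv that by (auto simp: O'_def C_def E_def)
        then have "card {u, v} \<le> card {y \<in> O'. p y = Inl e}" by (rule card_mono[rotated]) (use C in simp)
        then show ?thesis using uv by simp
      qed
      then have "(\<Sum>e\<in>E. 2) \<le> (\<Sum>e\<in>E. card {y \<in> O'. p y = Inl e})" by (rule sum_mono)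
      also have "\<dots> = card (\<Union>e\<in>E. {y \<in> O'. p y = Inl e})"
        by (rule card_UN_disjoint[symmetric]) (use finc C in \<open>auto simp: E_def\<close>)
      also have "\<dots> \<le> card O'" by (rule card_mono) (use C in auto)
      finally show ?thesis by simp
    qed
    ultimately have len: "n \<le> 2 * card O' + 1" using n(2) by linarith
    have "card O' + 1 \<le> card C" using x(2) cV unfolding C_def[symmetric] by linarith
    \<comment> \<open>One vertex more than in \<open>O'\<close>, so that the alternating path can
      start and end in \<open>C\<close>; this accounts for the final \<open>+ 1\<close> in the
      bound.\<close>
    then obtain T where T: "T \<subseteq> C" "card T = card O' + 1" "finite T"
      by (rule obtain_subset_with_card_n)
    have "O' \<inter> T = {}" using T by (auto simp: O'_def)
    then have cW: "card (O' \<union> T) = 2 * card O' + 1" using card_Un_disjoint[of O' T] C T by auto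
    have "2 * card {y \<in> O' \<union> T. p y = p z} \<le> card (O' \<union> T) + 1" if z: "z \<in> O' \<union> T" for z
    proof (cases "p z = p x")
      case True
      then have "{y \<in> O' \<union> T. p y = p z} \<subseteq> T" by (auto simp: O'_def C_def)
      then have "card {y \<in> O' \<union> T. p y = p z} \<le> card T" by (rule card_mono[OF T(3)])
      then show ?thesis using T cW by simp
    next
      case False
      then have "{y \<in> O' \<union> T. p y = p z} \<subseteq> O'" using T by (auto simp: C_def)
      then have "card {y \<in> O' \<union> T. p y = p z} \<le> card O'" by (rule card_mono[OF C(3)])
      then show ?thesis using cW by simp
    qed
    moreover have sub: "O' \<union> T \<subseteq> V" using T C by (auto simp: O'_def)
    ultimately obtain xs where xs: "distinct xs" "set xs = O' \<union> T" "successively (\<lambda>x y. g x y = d) xs"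
      using path by blast
    then show ?thesis using distinct_card[OF xs(1)] cW len sub by auto
  qed
qed

text \<open>Consecutive edges of the path share a vertex and avoid \<open>d\<close>, so
  \<open>dominant_edges\<close> gives them the same colour.\<close>

lemma dominant_connected_mono:
  assumes d: "dominant d" and xs: "distinct (x # y # zs)" "set (x # y # zs) \<subseteq> V"
    "successively (\<lambda>u v. g u v \<noteq> d) (x # y # zs)"
  shows "successively (\<lambda>u v. g u v = g x y) (x # y # zs)"
  using xs
proof (induction zs arbitrary: x y)
  case (Cons z zs)
  have "g y z = g y x" using dominant_edges[OF d, of y z x] Cons.prems g_sym[of x y] by auto
  moreover have "successively (\<lambda>u v. g u v = g y z) (y # z # zs)" using Cons by auto
  ultimately show ?case using g_sym[of x y] by simp
qed simp

lemma dominant_ramsey_path: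
  assumes d: "dominant d" and n: "2 \<le> n" "n + n div 2 - 1 \<le> card V"
  shows "\<exists>c xs. distinct xs \<and> set xs \<subseteq> V \<and> length xs = n \<and> successively (\<lambda>x y. g x y = c) xs"
proof -
  have "\<exists>c xs. distinct xs \<and> set xs \<subseteq> V \<and> length xs = n \<and> successively (\<lambda>x y. (g x y = d) = c) xs"
    by (rule gerencser_gyarfas) (use g_sym finite_V n in auto)
  then obtain c xs where xs: "distinct xs" "set xs \<subseteq> V" "length xs = n"
      "successively (\<lambda>x y. (g x y = d) = c) xs" by blast
  show ?thesis
  proof (cases c)
    case True
    then show ?thesis using xs by auto
  next
    case False
    obtain x y zs where zs: "xs = x # y # zs" using xs(3) n(1) by (metis Suc_le_length_iff numeral_2_eq_2)
    have "successively (\<lambda>u v. g u v = g x y) xs"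
      using dominant_connected_mono[OF d, of x y zs] xs False unfolding zs by simp
    then show ?thesis using xs by blast
  qed
qed

lemma mono_path_exists:
  assumes "4 \<le> card colors" "2 \<le> n" "n + 1 \<le> card V"
    and "n \<le> 4 * (card colors - 2) + 1 \<or> n + n div 2 - 1 \<le> card V"
  shows "\<exists>c xs. distinct xs \<and> set xs \<subseteq> V \<and> length xs = n \<and> successively (\<lambda>x y. g x y = c) xs"
proof -
  have trunc: ?thesis
    if "distinct xs" "set xs \<subseteq> V" "n \<le> length xs" "successively (\<lambda>x y. g x y = c) xs" for c xs
  proof -
    have "successively (\<lambda>x y. g x y = c) (take n xs)"
      using that(4) successively_append_iff[of _ "take n xs" "drop n xs"] by simp
    moreover have "distinct (take n xs)" "set (take n xs) \<subseteq> V" "length (take n xs) = n"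
      using that set_take_subset[of n xs] by auto
    ultimately show ?thesis by blast
  qed
  consider near_mono | d where "dominant d" using near_mono_or_dominant[OF assms(1)] by blast
  then show ?thesis
  proof cases
    case 1
    then obtain c xs where "distinct xs" "set xs \<subseteq> V" "length xs = card V - 1" "successively (\<lambda>x y. g x y = c) xs"
      using near_mono_path by blast
    then show ?thesis using trunc assms(3) by simp
  next
    case 2
    show ?thesis
      using assms(4) dominant_long_path[OF 2, of n] dominant_ramsey_path[OF 2 assms(2)] assms(3) trunc by auto
  qed
qed

end

section \<open>Gallai-Ramsey numbers\<close>

lemma nsets_2_conv: "nsets A 2 = {{x, y} | x y. x \<in> A \<and> y \<in> A \<and> x \<noteq> y}"
  by (auto simp: nsets_def card_2_iff)

lemma path_copy_of_list:
  assumes "distinct xs" "set xs \<subseteq> {..<m}" "length xs = n"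
  shows "is_copy_in (path_graph n) (complete_graph m) (set xs, {{xs ! i, xs ! Suc i} | i. Suc i < n})"
proof -
  have "bij_betw ((!) xs) {..<n} (set xs)"
    using bij_betw_nth[OF assms(1)] assms(3) by auto
  moreover have "{{xs ! i, xs ! Suc i} | i. Suc i < n} = (\<lambda>e. (!) xs ` e) ` {{i, Suc i} | i. Suc i < n}"
    by (simp add: setcompr_eq_image image_image)
  ultimately have "isomorphic (path_graph n) (set xs, {{xs ! i, xs ! Suc i} | i. Suc i < n})"
    unfolding isomorphic_def path_graph_def fst_conv snd_conv by blast
  moreover have "{xs ! i, xs ! Suc i} \<in> nsets {..<m} 2" if "Suc i < n" for i
  proof -
    have "xs ! i \<in> set xs" "xs ! Suc i \<in> set xs" using that assms(3) by auto
    moreover have "xs ! i \<noteq> xs ! Suc i" using that assms by (simp add: nth_eq_iff_index_eq)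
    ultimately show ?thesis using assms(2) unfolding nsets_2_conv by blast
  qed
  ultimately show ?thesis
    using assms unfolding is_copy_in_def is_subgraph_def complete_graph_def by auto
qed

lemma path_copyE:
  assumes "is_copy_in (path_graph n) (complete_graph m) X"
  obtains \<phi> where "inj_on \<phi> {..<n}" "\<phi> ` {..<n} \<subseteq> {..<m}" "uedges X = {{\<phi> i, \<phi> (Suc i)} | i. Suc i < n}"
proof -
  obtain \<phi> where "bij_betw \<phi> {..<n} (uverts X)" "uedges X = (\<lambda>e. \<phi> ` e) ` {{i, Suc i} | i. Suc i < n}"
    and "uverts X \<subseteq> {..<m}"
    using assms unfolding is_copy_in_def isomorphic_def is_subgraph_def path_graph_def complete_graph_def by auto
  then have "inj_on \<phi> {..<n}" "\<phi> ` {..<n} \<subseteq> {..<m}" "uedges X = {{\<phi> i, \<phi> (Suc i)} | i. Suc i < n}"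
    by (auto simp: bij_betw_def setcompr_eq_image image_image)
  then show thesis by (rule that)
qed

lemma gr_arrow_P5:
  assumes k: "4 \<le> k" and n: "2 \<le> n" and m: "7 \<le> m" "n + 1 \<le> m"
    and "n \<le> 4 * (k - 2) + 1 \<or> n + n div 2 - 1 \<le> m"
  shows "gr_arrow m k (path_graph 5) (path_graph n)"
  unfolding gr_arrow_def
proof (intro allI impI)
  fix f :: "nat set \<Rightarrow> nat"
  assume f: "exact_edge_coloring k (complete_graph m) f"
  have "\<exists>X. is_copy_in (path_graph n) (complete_graph m) X \<and> monochromatic f X"
    if no: "\<nexists>X. is_copy_in (path_graph 5) (complete_graph m) X \<and> rainbow f X"
  proof -
    define g where "g x y = f {x, y}" for x y
    interpret rainbow_P5_free "{..<m}" g
    proof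
      show "finite {..<m}" "7 \<le> card {..<m}" using m by auto
      show "g x y = g y x" for x y by (simp add: g_def insert_commute)
      fix p q r s t
      assume d: "distinct [p, q, r, s, t]" and V: "set [p, q, r, s, t] \<subseteq> {..<m}"
      have five: "{i. Suc i < 5} = {0, 1, 2, 3}" by auto
      have "{{[p, q, r, s, t] ! i, [p, q, r, s, t] ! Suc i} | i. Suc i < 5} = {{p, q}, {q, r}, {r, s}, {s, t}}"
        unfolding setcompr_eq_image five by simp
      then have "\<not> inj_on f {{p, q}, {q, r}, {r, s}, {s, t}}"
        using no path_copy_of_list[OF d V, of 5] unfolding rainbow_def by auto
      then show "\<not> distinct [g p q, g q r, g r s, g s t]"
        unfolding g_def by (auto simp: inj_on_def)
    qed
    have "colors = f ` uedges (complete_graph m)"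
      unfolding colors_def complete_graph_def nsets_2_conv g_def by auto
    then have "card colors = k" using f by (simp add: exact_edge_coloring_def)
    then obtain c xs where xs: "distinct xs" "set xs \<subseteq> {..<m}" "length xs = n"
        "successively (\<lambda>x y. g x y = c) xs"
      using mono_path_exists[of n] assms by auto
    have "monochromatic f (set xs, {{xs ! i, xs ! Suc i} | i. Suc i < n})"
      using xs(3,4) unfolding monochromatic_def successively_conv_nth g_def by auto
    then show "\<exists>X. is_copy_in (path_graph n) (complete_graph m) X \<and> monochromatic f X"
      using path_copy_of_list[OF xs(1-3)] by blast
  qed
  then show "(\<exists>X. is_copy_in (path_graph 5) (complete_graph m) X \<and> rainbow f X) \<or>
    (\<exists>X. is_copy_in (path_graph n) (complete_graph m) X \<and> monochromatic f X)" by blast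
qed

text \<open>Failure at \<open>N - 1\<close> excludes every smaller bound too, since a bound requires
  the arrow at all \<open>m\<close> from it on.\<close>

lemma gallai_ramsey_eqI:
  assumes "\<And>m. N \<le> m \<Longrightarrow> gr_arrow m k G H" and "0 < N" and "\<not> gr_arrow (N - 1) k G H"
  shows "gallai_ramsey k G H = enat N"
  unfolding gallai_ramsey_def
proof (rule Inf_eqI)
  show "enat N \<le> i" if "i \<in> {enat N |N. \<forall>m\<ge>N. gr_arrow m k G H}" for i
    using that assms(2,3) by (auto simp: not_less_eq_eq[symmetric]) (metis Suc_pred not_less_eq_eq)
next
  fix y assume "\<And>i. i \<in> {enat N |N. \<forall>m\<ge>N. gr_arrow m k G H} \<Longrightarrow> y \<le> i"
  then show "y \<le> enat N" using assms(1) by blast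
qed

section \<open>Lower bound colourings\<close>

lemma no_arrow_star:
  assumes n: "4 \<le> n" "k \<le> n" and k: "2 \<le> k"
  shows "\<not> gr_arrow n k (path_graph 5) (path_graph n)"
proof
  assume arrow: "gr_arrow n k (path_graph 5) (path_graph n)"
  \<comment> \<open>Edges off vertex 0 get colour 0; the edge from 0 to \<open>c\<close> gets colour
    \<open>c\<close>, capped at \<open>k - 1\<close>.\<close>
  define f :: "nat set \<Rightarrow> nat" where "f e = (if 0 \<in> e then min (Max e) (k - 1) else 0)" for e
  have f0: "f {x, y} = 0 \<longleftrightarrow> x \<noteq> 0 \<and> y \<noteq> 0" if "x \<noteq> y" for x y
    using that k by (auto simp: f_def max_def)
  have "f ` uedges (complete_graph n) = {..<k}"
  proof
    show "f ` uedges (complete_graph n) \<subseteq> {..<k}" using k by (auto simp: f_def)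
    show "{..<k} \<subseteq> f ` uedges (complete_graph n)"
    proof
      fix c assume c: "c \<in> {..<k}"
      have "\<exists>x y. x < n \<and> y < n \<and> x \<noteq> y \<and> c = f {x, y}"
      proof (cases "c = 0")
        case True
        then show ?thesis using n by (intro exI[of _ 1] exI[of _ 2]) (simp add: f_def)
      next
        case False
        then show ?thesis using c n by (intro exI[of _ 0] exI[of _ c]) (simp add: f_def)
      qed
      then show "c \<in> f ` uedges (complete_graph n)"
        unfolding complete_graph_def nsets_2_conv by auto
    qed
  qed
  then have "exact_edge_coloring k (complete_graph n) f" unfolding exact_edge_coloring_def by simp
  then consider X where "is_copy_in (path_graph 5) (complete_graph n) X" "rainbow f X"
    | X where "is_copy_in (path_graph n) (complete_graph n) X" "monochromatic f X"
    using arrow unfolding gr_arrow_def by blast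
  then show False
  proof cases
    case 1
    obtain \<phi> where \<phi>: "inj_on \<phi> {..<5}" "\<phi> ` {..<5} \<subseteq> {..<n}" "uedges X = {{\<phi> i, \<phi> (Suc i)} | i. Suc i < 5}"
      using path_copyE[OF 1(1)] .
    have ne: "\<phi> i \<noteq> \<phi> j" if "i < 5" "j < 5" "i \<noteq> j" for i j
      using \<phi>(1) that by (auto simp: inj_on_def)
    have mem: "{\<phi> i, \<phi> (Suc i)} \<in> uedges X" if "Suc i < 5" for i using \<phi>(3) that by auto
    have no_two: "\<not> (f {\<phi> i, \<phi> (Suc i)} = 0 \<and> f {\<phi> j, \<phi> (Suc j)} = 0)" if "i < j" "Suc j < 5" for i j
    proof
      assume "f {\<phi> i, \<phi> (Suc i)} = 0 \<and> f {\<phi> j, \<phi> (Suc j)} = 0"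
      then have "{\<phi> i, \<phi> (Suc i)} = {\<phi> j, \<phi> (Suc j)}"
        using inj_onD[OF 1(2)[unfolded rainbow_def], OF _ mem[of i] mem[of j]] that by simp
      then show False using ne[of i j] ne[of i "Suc j"] that by (auto simp: doubleton_eq_iff)
    qed
    have edge_zero: "f {\<phi> i, \<phi> (Suc i)} = 0 \<longleftrightarrow> \<phi> i \<noteq> 0 \<and> \<phi> (Suc i) \<noteq> 0" if "Suc i < 5" for i
      by (rule f0, rule ne) (use that in auto)
    have zero: "\<phi> i = 0 \<or> \<phi> (Suc i) = 0 \<or> \<phi> j = 0 \<or> \<phi> (Suc j) = 0" if "i < j" "Suc j < 5" for i j
      using no_two[OF that] edge_zero[of i] edge_zero[of j] that by simp
    have uniq: "i = j" if "\<phi> i = 0" "\<phi> j = 0" "i < 5" "j < 5" for i j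
      using ne[of i j] that by auto
    \<comment> \<open>Of any two edges of the path one contains vertex 0, as colour 0 occurs at most
      once. No single position of vertex 0 satisfies all three disjunctions.\<close>
    have "\<phi> 0 = 0 \<or> \<phi> 1 = 0 \<or> \<phi> 2 = 0" "\<phi> 2 = 0 \<or> \<phi> 3 = 0 \<or> \<phi> 4 = 0"
      "\<phi> 0 = 0 \<or> \<phi> 1 = 0 \<or> \<phi> 3 = 0 \<or> \<phi> 4 = 0"
      using zero[of 0 1] zero[of 2 3] zero[of 0 3] by (simp_all add: eval_nat_numeral)
    then show False
      using uniq[of 0 2] uniq[of 0 3] uniq[of 0 4] uniq[of 1 2] uniq[of 1 3] uniq[of 1 4] uniq[of 2 3] uniq[of 2 4]
      by force
  next
    case 2
    obtain \<phi> where \<phi>: "inj_on \<phi> {..<n}" "\<phi> ` {..<n} \<subseteq> {..<n}" "uedges X = {{\<phi> i, \<phi> (Suc i)} | i. Suc i < n}"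
      using path_copyE[OF 2(1)] .
    have ne: "\<phi> i \<noteq> \<phi> j" if "i < n" "j < n" "i \<noteq> j" for i j
      using \<phi>(1) that by (auto simp: inj_on_def)
    obtain c where "\<forall>e \<in> uedges X. f e = c" using 2(2) unfolding monochromatic_def ..
    then have c: "f {\<phi> i, \<phi> (Suc i)} = c" if "Suc i < n" for i using \<phi>(3) that by auto
    have "\<phi> ` {..<n} = {..<n}" using \<phi> by (intro endo_inj_surj) auto
    moreover have "0 \<in> {..<n}" using n by simp
    ultimately obtain j where j: "j < n" "\<phi> j = 0" by (metis imageE lessThan_iff)
    obtain i where i: "Suc i < n" "i = j \<or> Suc i = j"
      using j n by (cases j) (auto intro: that[of 0])
    then have "c \<noteq> 0" using c[of i] f0[of "\<phi> i" "\<phi> (Suc i)"] j ne[of i "Suc i"] by auto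
    \<comment> \<open>An edge of the path off vertex 0, which exists since \<open>n\<close> is at
      least 4.\<close>
    moreover obtain i' where i': "Suc i' < n" "i' \<noteq> j" "Suc i' \<noteq> j"
      using n that[of "if j \<le> 1 then 2 else 0"] by auto
    then have "c = 0"
      using c[of i'] f0[of "\<phi> i'" "\<phi> (Suc i')"] j ne[of i' "Suc i'"] ne[of i' j] ne[of "Suc i'" j] by auto
    ultimately show False by simp
  qed
qed

lemma no_arrow_classes:
  assumes k: "2 \<le> k" and n: "4 * (k - 2) + 1 < n" "4 \<le> n"
  shows "\<not> gr_arrow (n + n div 2 - 2) k (path_graph 5) (path_graph n)"
proof
  define m where "m = n + n div 2 - 2"
  assume arrow: "gr_arrow (n + n div 2 - 2) k (path_graph 5) (path_graph n)"
  \<comment> \<open>Class 0 is formed by the first \<open>n - 1\<close> vertices; the remaining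
    \<open>n div 2 - 1\<close> vertices are paired off into classes 1, 2 and so on. Only classes
    with index below \<open>k - 1\<close> receive a colour of their own.\<close>
  define h where "h v = (if v < n - 1 then 0 else (v - (n - 1)) div 2 + 1)" for v
  define f :: "nat set \<Rightarrow> nat" where
    "f e = (if h (Min e) = h (Max e) \<and> h (Min e) < k - 1 then Suc (h (Min e)) else 0)" for e
  have f: "f {x, y} = (if h x = h y \<and> h x < k - 1 then Suc (h x) else 0)" for x y
    by (cases x y rule: linorder_cases) (auto simp: f_def min_def max_def)
  have "f ` uedges (complete_graph m) = {..<k}"
  proof
    show "f ` uedges (complete_graph m) \<subseteq> {..<k}" using k by (auto simp: f_def)
    show "{..<k} \<subseteq> f ` uedges (complete_graph m)"
    proof
      fix c assume c: "c \<in> {..<k}"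
      have "\<exists>x y. x < m \<and> y < m \<and> x \<noteq> y \<and> c = f {x, y}"
      proof -
        consider "c = 0" | "c = 1" | j where "c = j + 2" by (metis add_2_eq_Suc' not0_implies_Suc One_nat_def)
        then show ?thesis
        proof cases
          case 1
          then show ?thesis using n by (intro exI[of _ 0] exI[of _ "n - 1"]) (simp add: f h_def m_def)
        next
          case 2
          have "1 < m" using n(2) unfolding m_def by linarith
          moreover have "h 0 = 0" "h 1 = 0" using n(2) by (simp_all add: h_def)
          ultimately show ?thesis using 2 k by (intro exI[of _ 0] exI[of _ 1]) (simp add: f)
        next
          case 3
          have "j < k - 2" using 3 c by auto
          \<comment> \<open>The lower bound on \<open>n\<close> is exactly what makes
            \<open>k - 2\<close> pairs fit among the further vertices.\<close>
          then have "2 * j + 1 < n div 2 - 1" using n(1) by linarith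
          then have "n - 1 + 2 * j < m" "n - 1 + 2 * j + 1 < m" using n unfolding m_def by linarith+
          then show ?thesis using n 3 c
            by (intro exI[of _ "n - 1 + 2 * j"] exI[of _ "n - 1 + 2 * j + 1"]) (auto simp add: f h_def)
        qed
      qed
      then show "c \<in> f ` uedges (complete_graph m)"
        unfolding complete_graph_def nsets_2_conv by auto
    qed
  qed
  then have "exact_edge_coloring k (complete_graph m) f" unfolding exact_edge_coloring_def by simp
  then consider X where "is_copy_in (path_graph 5) (complete_graph m) X" "rainbow f X"
    | X where "is_copy_in (path_graph n) (complete_graph m) X" "monochromatic f X"
    using arrow unfolding gr_arrow_def m_def by blast
  then show False
  proof cases
    case 1
    obtain \<phi> where \<phi>: "inj_on \<phi> {..<5}" "\<phi> ` {..<5} \<subseteq> {..<m}" "uedges X = {{\<phi> i, \<phi> (Suc i)} | i. Suc i < 5}"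
      using path_copyE[OF 1(1)] .
    have mem: "{\<phi> i, \<phi> (Suc i)} \<in> uedges X" if "Suc i < 5" for i using \<phi>(3) that by auto
    have ne: "f {\<phi> i, \<phi> (Suc i)} \<noteq> f {\<phi> j, \<phi> (Suc j)}" if "i < j" "Suc j < 5" for i j
    proof
      assume "f {\<phi> i, \<phi> (Suc i)} = f {\<phi> j, \<phi> (Suc j)}"
      then have "{\<phi> i, \<phi> (Suc i)} = {\<phi> j, \<phi> (Suc j)}"
        using inj_onD[OF 1(2)[unfolded rainbow_def], OF _ mem[of i] mem[of j]] that by simp
      then have "\<phi> i = \<phi> j \<or> \<phi> i = \<phi> (Suc j)" by (auto simp: doubleton_eq_iff)
      then show False
        using inj_onD[OF \<phi>(1), of i j] inj_onD[OF \<phi>(1), of i "Suc j"] that by auto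
    qed
    \<comment> \<open>Adjacent edges of nonzero colour lie in one class and so have the same colour.
      Hence each half of the path has an edge of colour 0.\<close>
    have z: "f {\<phi> i, \<phi> (Suc i)} = 0 \<or> f {\<phi> (Suc i), \<phi> (Suc (Suc i))} = 0" if "Suc (Suc i) < 5" for i
      using ne[of i "Suc i"] that by (auto simp: f)
    show False using z[of 0] z[of 2] ne[of 0 2] ne[of 0 3] ne[of 1 2] ne[of 1 3]
      by (auto simp: eval_nat_numeral)
  next
    case 2
    obtain \<phi> where \<phi>: "inj_on \<phi> {..<n}" "\<phi> ` {..<n} \<subseteq> {..<m}" "uedges X = {{\<phi> i, \<phi> (Suc i)} | i. Suc i < n}"
      using path_copyE[OF 2(1)] .
    obtain c where "\<forall>e \<in> uedges X. f e = c" using 2(2) unfolding monochromatic_def ..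
    then have c: "f {\<phi> i, \<phi> (Suc i)} = c" if "Suc i < n" for i using \<phi>(3) that by auto
    consider "c = 0" | "c = 1" | "2 \<le> c" by linarith
    then show False
    proof cases
      case 1
      \<comment> \<open>Colour 0 does not occur among the first \<open>n - 1\<close> vertices, so
        each of \<open>n div 2\<close> disjoint edges of the path has an end outside them, chosen by
        \<open>\<psi>\<close>; only \<open>n div 2 - 1\<close> vertices are there.\<close>
      define \<psi> where "\<psi> j = (if \<phi> (2 * j) < n - 1 then \<phi> (2 * j + 1) else \<phi> (2 * j))" for j
      have "\<psi> ` {..<n div 2} \<subseteq> {n - 1..<m}"
      proof (clarify)
        fix j assume "j < n div 2"
        then have j: "Suc (2 * j) < n" by linarith
        then have "2 * j \<in> {..<n}" "2 * j + 1 \<in> {..<n}" by auto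
        then have "\<phi> (2 * j) < m" "\<phi> (2 * j + 1) < m" using \<phi>(2) by blast+
        moreover have "\<not> (\<phi> (2 * j) < n - 1 \<and> \<phi> (2 * j + 1) < n - 1)"
          using c[OF j] 1 k by (auto simp: f h_def split: if_splits)
        ultimately show "\<psi> j \<in> {n - 1..<m}" by (auto simp: \<psi>_def)
      qed
      moreover have "inj_on \<psi> {..<n div 2}"
      proof (rule inj_onI)
        fix i j assume ij: "i \<in> {..<n div 2}" "j \<in> {..<n div 2}" "\<psi> i = \<psi> j"
        then have "2 * i + 1 < n" "2 * j + 1 < n" by auto
        moreover obtain a b where "\<psi> i = \<phi> (2 * i + a)" "\<psi> j = \<phi> (2 * j + b)" "a \<le> 1" "b \<le> 1"
          unfolding \<psi>_def by (metis add_0_right le_refl zero_le_one)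
        ultimately have "2 * i + a = 2 * j + b"
          using \<phi>(1) ij(3) unfolding inj_on_def by (metis add_le_cancel_left lessThan_iff order_le_less_trans)
        then show "i = j" using \<open>a \<le> 1\<close> \<open>b \<le> 1\<close> by presburger
      qed
      ultimately have "card {..<n div 2} \<le> card {n - 1..<m}"
        by (intro card_inj_on_le[of \<psi>]) auto
      then show False using n(2) by (simp add: m_def)
    next
      case 2
      have "\<phi> i < n - 1" if i: "i < n" for i
      proof -
        obtain j where j: "Suc j < n" "i = j \<or> i = Suc j"
          using i n(2) by (cases i) (auto intro: that[of 0])
        have "h (\<phi> j) = 0" "h (\<phi> (Suc j)) = 0" using c[OF j(1)] 2 by (auto simp: f split: if_splits)
        then have "h (\<phi> i) = 0" using j(2) by auto
        then show ?thesis by (simp add: h_def split: if_splits)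
      qed
      then have "\<phi> ` {..<n} \<subseteq> {..<n - 1}" by auto
      then have "card {..<n} \<le> card {..<n - 1}" using \<phi>(1) by (intro card_inj_on_le[of \<phi>]) auto
      then show False using n(2) by simp
    next
      case 3
      have "h (\<phi> 0) = c - 1" "h (\<phi> 1) = c - 1" "h (\<phi> 2) = c - 1"
        using c[of 0] c[of 1] n(2) 3 by (auto simp: f eval_nat_numeral split: if_splits)
      moreover have "x \<in> {n - 1 + 2 * (c - 2)..<n - 1 + 2 * (c - 2) + 2}" if "h x = c - 1" for x
      proof -
        have "n - 1 \<le> x" "(x - (n - 1)) div 2 = c - 2"
          using that 3 by (auto simp: h_def split: if_splits)
        then have "x - (n - 1) < 2 * (c - 2) + 2" "2 * (c - 2) \<le> x - (n - 1)" by linarith+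
        then show ?thesis using \<open>n - 1 \<le> x\<close> by auto
      qed
      ultimately have "\<phi> ` {0, 1, 2} \<subseteq> {n - 1 + 2 * (c - 2)..<n - 1 + 2 * (c - 2) + 2}" by blast
      moreover have "inj_on \<phi> {0, 1, 2}" by (rule inj_on_subset[OF \<phi>(1)]) (use n(2) in auto)
      ultimately have "card {0, 1, 2 :: nat} \<le> card {n - 1 + 2 * (c - 2)..<n - 1 + 2 * (c - 2) + 2}"
        by (intro card_inj_on_le[of \<phi>]) auto
      then show False by simp
    qed
  qed
qed

lemma ceiling_three_halves:
  assumes "2 \<le> n"
  shows "nat \<lceil>(3 * real n - 3) / 2\<rceil> = n + n div 2 - 1"
proof -
  have "\<lceil>(3 * real n - 3) / 2\<rceil> = int (n + n div 2 - 1)"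
  proof (cases "even n")
    case True
    then obtain j where "n = 2 * j" by (elim evenE)
    then show ?thesis using assms by (intro ceiling_unique) (auto simp: of_nat_diff)
  next
    case False
    then obtain j where "n = 2 * j + 1" by (elim oddE)
    then show ?thesis using assms by (intro ceiling_unique) (auto simp: of_nat_diff)
  qed
  then show ?thesis by simp
qed

theorem theorem1p7:
  fixes n k :: nat
  assumes "n \<ge> k" and "k \<ge> 4"
  shows "(2 * (k - 1) \<le> n \<and> n \<le> 4 * (k - 2) + 1 \<longrightarrow>
            gallai_ramsey k (path_graph 5) (path_graph n) = enat (n + 1))
       \<and> (n > 4 * (k - 2) + 1 \<longrightarrow>
            gallai_ramsey k (path_graph 5) (path_graph n) = enat (nat \<lceil>(3 * real n - 3) / 2\<rceil>))"
proof (intro conjI impI)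
  assume n: "2 * (k - 1) \<le> n \<and> n \<le> 4 * (k - 2) + 1"
  show "gallai_ramsey k (path_graph 5) (path_graph n) = enat (n + 1)"
  proof (rule gallai_ramsey_eqI)
    \<comment> \<open>Here \<open>n\<close> is at least 6, which gives the seven vertices
      required.\<close>
    show "gr_arrow m k (path_graph 5) (path_graph n)" if "n + 1 \<le> m" for m
      using that n assms by (intro gr_arrow_P5) auto
    show "\<not> gr_arrow (n + 1 - 1) k (path_graph 5) (path_graph n)"
      using no_arrow_star[of n k] assms by simp
  qed simp
next
  assume n: "n > 4 * (k - 2) + 1"
  have "gallai_ramsey k (path_graph 5) (path_graph n) = enat (n + n div 2 - 1)"
  proof (rule gallai_ramsey_eqI)
    show "gr_arrow m k (path_graph 5) (path_graph n)" if m: "n + n div 2 - 1 \<le> m" for m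
    proof (rule gr_arrow_P5)
      show "2 \<le> n" "7 \<le> m" "n + 1 \<le> m" using m n assms by linarith+
    qed (use assms m in simp_all)
    show "\<not> gr_arrow (n + n div 2 - 1 - 1) k (path_graph 5) (path_graph n)"
      using no_arrow_classes[of k n] n assms by (simp add: numeral_2_eq_2)
  qed (use assms in simp)
  then show "gallai_ramsey k (path_graph 5) (path_graph n) = enat (nat \<lceil>(3 * real n - 3) / 2\<rceil>)"
    using ceiling_three_halves[of n] assms by simp
qed

end
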